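(* Let $d\in\mathbb{N}^*$ be fixed. For each $n\in\mathbb{N}^*$, let $(X_1,X_2,\ldots)$ be independent random variables with uniform distribution on the discrete torus $\mathbb{T}_n^d$, and let \[\tau_n^{\mathsf{cc}}=\inf\left\{k\in\mathbb{N}:\bigcup_{i=1}^k\overline{B}(X_i,k-i)=\mathbb{T}_n^d\right\}.\] Then, as $n\to\infty$, \[\left(\frac{d!}{2^d}\cdot n^d\cdot\ln\left(n^d\right)\right)^{-1/(d+1)}\cdot\tau_n^{\mathsf{cc}}\longrightarrow 1\quad\text{in probability.}\]
   Context: Notation: $\mathbb{N}=\{0,1,2,\ldots\}$ and $\mathbb{N}^*=\{1,2,\ldots\}$. For $n\in\mathbb{N}^*$, $\mathbb{T}_n^d$ is the discrete Euclidean torus $\mathbb{Z}^d/n\mathbb{Z}^d$ with side length $n$, equipped with its natural (nearest-neighbour) graph structure. $\overline{B}(x,r)$ denotes the closed ball of radius $r$ around the vertex $x$ for the graph distance in $\mathbb{T}_n^d$ (the dependence on $n$ is omitted from the notation). The sequence $(X_1,X_2,\ldots)$ depends on $n$. *)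

theory Defs
  imports "HOL-Probability.Probability"
begin

text \<open>
  The torus \<open>\<int>\<^sup>d / n\<int>\<^sup>d\<close> (for \<open>n \<ge> 1\<close>) is represented by the coordinate vectors with entries in
  \<open>{0..<n}\<close>, indexed by \<open>{..<d}\<close>; addition of coordinates is modulo \<open>n\<close>.
\<close>

definition torus :: "nat \<Rightarrow> nat \<Rightarrow> (nat \<Rightarrow> int) set" where
  "torus d n = {..<d} \<rightarrow>\<^sub>E {0..<int n}"

definition torus_edges :: "nat \<Rightarrow> nat \<Rightarrow> ((nat \<Rightarrow> int) \<times> (nat \<Rightarrow> int)) set" where
  "torus_edges d n =
     {(x, y). x \<in> torus d n \<and> y \<in> torus d n \<and> x \<noteq> y \<and>
        (\<exists>i<d. \<exists>s\<in>{1, -1}. y = x(i := (x i + s) mod int n))}"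

text \<open>
  A pair is in \<open>E ^^ m\<close> iff its components are joined by a walk with \<open>m\<close> edges. The torus is
  connected, so the minimum exists for any two vertices.
\<close>

definition torus_dist :: "nat \<Rightarrow> nat \<Rightarrow> (nat \<Rightarrow> int) \<Rightarrow> (nat \<Rightarrow> int) \<Rightarrow> nat" where
  "torus_dist d n x y = (LEAST m. (x, y) \<in> torus_edges d n ^^ m)"

definition torus_cball :: "nat \<Rightarrow> nat \<Rightarrow> (nat \<Rightarrow> int) \<Rightarrow> nat \<Rightarrow> (nat \<Rightarrow> int) set" where
  "torus_cball d n x r = {y \<in> torus d n. torus_dist d n x y \<le> r}"

text \<open>
  The infimum is over a nonempty set when \<open>n \<ge> 1\<close> and \<open>x 1\<close> is a vertex of the torus: the ball
  around \<open>x 1\<close> alone covers the torus once its radius \<open>k - 1\<close> reaches the diameter. The value \<open>\<infinity>\<close>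
  is therefore never needed. The entry \<open>x 0\<close> is not used.
\<close>

definition cc_time :: "nat \<Rightarrow> nat \<Rightarrow> (nat \<Rightarrow> nat \<Rightarrow> int) \<Rightarrow> nat" where
  "cc_time d n x = Inf {k. (\<Union>i\<in>{1..k}. torus_cball d n (x i) (k - i)) = torus d n}"

text \<open>
  Convergence in probability to a constant, where the \<open>n\<close>-th variable may live on its own
  probability space.
\<close>

definition tendsto_in_prob ::
  "(nat \<Rightarrow> 'a measure) \<Rightarrow> (nat \<Rightarrow> 'a \<Rightarrow> real) \<Rightarrow> real \<Rightarrow> bool" where
  "tendsto_in_prob M Y c \<longleftrightarrow>
     (\<forall>\<epsilon>>0. (\<lambda>n. measure (M n) {\<omega> \<in> space (M n). \<bar>Y n \<omega> - c\<bar> > \<epsilon>}) \<longlonglongrightarrow> 0)"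

end

theory Submission
  imports Defs "HOL-Real_Asymp.Real_Asymp"
begin

text \<open>
  Write \<open>N = n\<^sup>d\<close>, \<open>T\<close> for the claimed value of the covering time, and \<open>V r\<close> for the number of vertices
  in a ball of radius \<open>r\<close>. A given vertex is uncovered at time \<open>k\<close> with probability
  \<open>\<Prod>r<k. 1 - V r / N\<close>. As \<open>V r\<close> is asymptotic to \<open>2\<^sup>d r\<^sup>d / d!\<close> for balls that do not wrap around the torus,
  this is about \<open>exp (- 2\<^sup>d k\<^sup>d\<^sup>+\<^sup>1 / ((d + 1)! N))\<close>, which at \<open>k = c T\<close> equals \<open>N\<close> to the power
  \<open>- c\<^sup>d\<^sup>+\<^sup>1 / (d + 1)\<close>. At \<open>k = T\<close> the expected number of uncovered vertices is therefore still
  large. Uncovered vertices come in clusters, however, of diameter comparable to \<open>T\<close> up to logarithms,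
  and there are only about \<open>(n / T)\<^sup>d\<close> independent places for a cluster, which is \<open>N\<close> to the power
  \<open>1 / (d + 1)\<close> up to logarithms. Hence the threshold \<open>c = 1\<close>.

  Upper bound (\<open>prob_cc_time_gt\<close>, \<open>cc_time_upper_tail\<close>): if some vertex is uncovered at time
  \<open>k = (1 + \<epsilon>) T\<close>, then its ball of radius \<open>j = \<epsilon> T / 2\<close> is uncovered at time \<open>k - j\<close>
  (\<open>missed_earlier\<close>). This ball contains a point of a grid with \<open>O((n / T)\<^sup>d)\<close> points, and the union
  bound over the grid suffices.

  Lower bound (\<open>prob_cc_time_le\<close>, \<open>cc_time_lower_tail\<close>): for \<open>k = (1 - \<epsilon>) T\<close>, take of the order of
  \<open>(n / T)\<^sup>d\<close> grid points whose balls of radius \<open>k\<close> are disjoint. The events that they are uncovered at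
  time \<open>k\<close> are pairwise negatively correlated (\<open>prob_missed_both\<close>) and their expected number tends to
  infinity, so that by the second moment method (\<open>second_moment_avoidance\<close>) one of them occurs with
  probability tending to 1.

  The balls are counted by identifying them with \<open>\<ell>\<^sup>1\<close> balls of \<open>\<int>\<^sup>d\<close> (\<open>torus_cball_eq\<close>).
\<close>

section \<open>Balls of the torus and of the integer lattice\<close>

text \<open>
  The \<open>\<ell>\<^sup>1\<close> ball of radius \<open>r\<close> around the origin of \<open>\<int>\<^sup>d\<close>. Vectors are extensional functions on
  \<open>{..<d}\<close>, so that equal vectors are equal as functions and the ball is finite.
\<close>

definition lattice_ball :: "nat \<Rightarrow> nat \<Rightarrow> (nat \<Rightarrow> int) set" where
  "lattice_ball d r = {z \<in> {..<d} \<rightarrow>\<^sub>E UNIV. (\<Sum>i<d. \<bar>z i\<bar>) \<le> int r}"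

text \<open>
  The vertex reached from \<open>x\<close> by the displacement \<open>z\<close>, that is \<open>x + z\<close> reduced modulo \<open>n\<close>.
\<close>

definition torus_shift :: "nat \<Rightarrow> nat \<Rightarrow> (nat \<Rightarrow> int) \<Rightarrow> (nat \<Rightarrow> int) \<Rightarrow> nat \<Rightarrow> int" where
  "torus_shift d n x z = (\<lambda>i\<in>{..<d}. (x i + z i) mod int n)"

lemma torus_shift_in_torus: "n \<ge> 1 \<Longrightarrow> torus_shift d n x z \<in> torus d n"
  by (auto simp: torus_shift_def torus_def)

lemma torus_coordD: "x \<in> torus d n \<Longrightarrow> i < d \<Longrightarrow> 0 \<le> x i \<and> x i < int n"
  by (auto simp: torus_def PiE_iff)

lemma torus_extD: "x \<in> torus d n \<Longrightarrow> \<not> i < d \<Longrightarrow> x i = undefined"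
  by (auto simp: torus_def PiE_iff extensional_def)

lemma finite_torus: "finite (torus d n)"
  by (auto simp: torus_def intro!: finite_PiE)

lemma card_torus: "card (torus d n) = n ^ d"
  by (simp add: torus_def card_PiE)

lemma sum_abs_fun_upd:
  fixes z :: "nat \<Rightarrow> int"
  assumes "i < d"
  shows "(\<Sum>j<d. \<bar>(z(i := c)) j\<bar>) = (\<Sum>j<d. \<bar>z j\<bar>) - \<bar>z i\<bar> + \<bar>c\<bar>"
proof -
  have "(\<Sum>j<d. \<bar>(z(i := c)) j\<bar>) = \<bar>c\<bar> + (\<Sum>j\<in>{..<d} - {i}. \<bar>(z(i := c)) j\<bar>)"
    using assms by (subst sum.remove[of _ i]) auto
  moreover have "(\<Sum>j\<in>{..<d} - {i}. \<bar>(z(i := c)) j\<bar>) = (\<Sum>j\<in>{..<d} - {i}. \<bar>z j\<bar>)"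
    by (intro sum.cong) auto
  moreover have "(\<Sum>j<d. \<bar>z j\<bar>) = \<bar>z i\<bar> + (\<Sum>j\<in>{..<d} - {i}. \<bar>z j\<bar>)"
    using assms by (subst sum.remove[of _ i]) auto
  ultimately show ?thesis by simp
qed

lemma lattice_ball_coordD:
  assumes "z \<in> lattice_ball d r" "i < d"
  shows "\<bar>z i\<bar> \<le> int r"
proof -
  have "\<bar>z i\<bar> \<le> (\<Sum>i<d. \<bar>z i\<bar>)"
    using assms(2) by (intro member_le_sum) auto
  then show ?thesis using assms(1) by (simp add: lattice_ball_def)
qed

lemma walk_displacement:
  assumes "(x, y) \<in> torus_edges d n ^^ m" "x \<in> torus d n"
  shows "\<exists>z\<in>lattice_ball d m. y = torus_shift d n x z"
  using assms
proof (induction m arbitrary: y)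
  case 0
  then have "y = torus_shift d n x (\<lambda>i\<in>{..<d}. 0)"
    using torus_coordD[OF 0(2)] torus_extD[OF 0(2)] by (auto simp: torus_shift_def fun_eq_iff)
  moreover have "(\<lambda>i\<in>{..<d}. 0) \<in> lattice_ball d 0" by (auto simp: lattice_ball_def)
  ultimately show ?case by blast
next
  case (Suc m)
  then obtain w where w: "(x, w) \<in> torus_edges d n ^^ m" "(w, y) \<in> torus_edges d n" by auto
  with Suc obtain z where z: "z \<in> lattice_ball d m" "w = torus_shift d n x z" by blast
  from w(2) obtain i s where i: "i < d" "s \<in> {1, -1}" "y = w(i := (w i + s) mod int n)"
    unfolding torus_edges_def by blast
  have "(\<Sum>j<d. \<bar>(z(i := z i + s)) j\<bar>) \<le> (\<Sum>j<d. \<bar>z j\<bar>) + 1"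
    using i by (subst sum_abs_fun_upd) auto
  then have "z(i := z i + s) \<in> lattice_ball d (Suc m)"
    using z(1) i(1) by (auto simp: lattice_ball_def PiE_iff extensional_def)
  moreover have "y = torus_shift d n x (z(i := z i + s))"
    using i z(2) by (auto simp: torus_shift_def fun_eq_iff mod_simps add.assoc)
  ultimately show ?case by blast
qed

lemma displacement_walk:
  assumes "n \<ge> 1" "x \<in> torus d n" "z \<in> lattice_ball d m"
  shows "\<exists>l\<le>m. (x, torus_shift d n x z) \<in> torus_edges d n ^^ l"
  using assms(2,3)
proof (induction m arbitrary: x z)
  case 0
  have "z i = 0" if "i < d" for i
    using lattice_ball_coordD[OF 0(2) that] by simp
  then have "torus_shift d n x z = x"
    using torus_coordD[OF 0(1)] torus_extD[OF 0(1)] by (auto simp: torus_shift_def fun_eq_iff)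
  then show ?case by auto
next
  case (Suc m)
  show ?case
  proof (cases "\<forall>i<d. z i = 0")
    case True
    then have "torus_shift d n x z = x"
      using torus_coordD[OF Suc(2)] torus_extD[OF Suc(2)] by (auto simp: torus_shift_def fun_eq_iff)
    then show ?thesis by (intro exI[of _ 0]) auto
  next
    case False
    then obtain i where i: "i < d" "z i \<noteq> 0" by blast
    \<comment> \<open>One step in a direction where \<open>z\<close> is nonzero shortens the remaining displacement by one.\<close>
    define s where "s = sgn (z i)"
    define x' where "x' = x(i := (x i + s) mod int n)"
    define z' where "z' = z(i := z i - s)"
    have s: "s \<in> {1, -1}" "\<bar>z i - s\<bar> = \<bar>z i\<bar> - 1" using i(2) by (auto simp: s_def sgn_if)
    have "(\<Sum>j<d. \<bar>z' j\<bar>) = (\<Sum>j<d. \<bar>z j\<bar>) - 1"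
      unfolding z'_def using i(1) s by (subst sum_abs_fun_upd) auto
    then have z': "z' \<in> lattice_ball d m"
      using Suc.prems(2) i(1) by (auto simp: lattice_ball_def z'_def PiE_iff extensional_def)
    have x': "x' \<in> torus d n"
      using Suc.prems(1) i(1) assms(1) by (auto simp: torus_def x'_def PiE_iff extensional_def)
    have eq: "torus_shift d n x' z' = torus_shift d n x z"
      by (auto simp: torus_shift_def fun_eq_iff x'_def z'_def mod_simps)
    obtain l where l: "l \<le> m" "(x', torus_shift d n x z) \<in> torus_edges d n ^^ l"
      using Suc.IH[OF x' z'] eq by auto
    show ?thesis
    \<comment> \<open>For \<open>n = 1\<close> the step is a loop, which is not an edge: it is left out of the walk.\<close>
    proof (cases "x' = x")
      case True
      then show ?thesis using l by (intro exI[of _ l]) auto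
    next
      case False
      then have "(x, x') \<in> torus_edges d n"
        using i(1) s(1) x' Suc.prems(1) unfolding torus_edges_def x'_def by auto
      then have "(x, torus_shift d n x z) \<in> torus_edges d n ^^ Suc l"
        using l(2) by (rule relpow_Suc_I2)
      then show ?thesis using l(1) by (intro exI[of _ "Suc l"]) auto
    qed
  qed
qed

lemma lattice_ball_mono: "r \<le> s \<Longrightarrow> lattice_ball d r \<subseteq> lattice_ball d s"
  unfolding lattice_ball_def 
proof (intro Collect_mono impI)
  fix z :: "nat \<Rightarrow> int"
  assume "r \<le> s" "z \<in> {..<d} \<rightarrow>\<^sub>E UNIV \<and> (\<Sum>i<d. \<bar>z i\<bar>) \<le> int r"
  then show "z \<in> {..<d} \<rightarrow>\<^sub>E UNIV \<and> (\<Sum>i<d. \<bar>z i\<bar>) \<le> int s" by linarith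
qed

text \<open>
  Balls of the graph metric are projections of lattice balls. The inclusion from left to right also
  needs that the torus is connected: only then is the minimum defining the distance attained.
\<close>

lemma torus_cball_eq:
  assumes "n \<ge> 1" "x \<in> torus d n"
  shows "torus_cball d n x r = torus_shift d n x ` lattice_ball d r"
proof (intro equalityI subsetI)
  fix y assume y: "y \<in> torus_cball d n x r"
  then have yt: "y \<in> torus d n" by (auto simp: torus_cball_def)
  define z where "z = (\<lambda>i\<in>{..<d}. y i - x i)"
  have "y = torus_shift d n x z"
    using torus_coordD[OF yt] torus_extD[OF yt] by (auto simp: torus_shift_def z_def fun_eq_iff)
  moreover have "z \<in> lattice_ball d (nat (\<Sum>i<d. \<bar>z i\<bar>))"
    by (auto simp: lattice_ball_def z_def sum_nonneg)
  ultimately obtain l where "(x, y) \<in> torus_edges d n ^^ l"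
    using displacement_walk[OF assms] by metis
  then have "(x, y) \<in> torus_edges d n ^^ torus_dist d n x y"
    unfolding torus_dist_def by (rule LeastI)
  then obtain z where "z \<in> lattice_ball d (torus_dist d n x y)" "y = torus_shift d n x z"
    using walk_displacement assms(2) by blast
  then show "y \<in> torus_shift d n x ` lattice_ball d r"
    using y lattice_ball_mono[of "torus_dist d n x y" r d] by (auto simp: torus_cball_def)
next
  fix y assume "y \<in> torus_shift d n x ` lattice_ball d r"
  then obtain z where z: "z \<in> lattice_ball d r" "y = torus_shift d n x z" by blast
  obtain l where l: "l \<le> r" "(x, y) \<in> torus_edges d n ^^ l"
    using displacement_walk[OF assms z(1)] z(2) by blast
  have "torus_dist d n x y \<le> l" unfolding torus_dist_def using l(2) by (rule Least_le)
  then show "y \<in> torus_cball d n x r"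
    using l z(2) torus_shift_in_torus[OF assms(1)] by (auto simp: torus_cball_def)
qed

lemma torus_cball_subset: "torus_cball d n x r \<subseteq> torus d n"
  by (auto simp: torus_cball_def)

lemma torus_cball_mono: "r \<le> s \<Longrightarrow> torus_cball d n x r \<subseteq> torus_cball d n x s"
  by (auto simp: torus_cball_def)

lemma torus_shift_compose:
  "torus_shift d n (torus_shift d n x z) w = torus_shift d n x (\<lambda>i\<in>{..<d}. z i + w i)"
  by (auto simp: torus_shift_def fun_eq_iff mod_simps add.assoc)

lemma torus_shift_self:
  assumes "x \<in> torus d n" "y \<in> torus d n"
  shows "torus_shift d n x (\<lambda>i\<in>{..<d}. y i - x i) = y"
  using torus_coordD[OF assms(2)] torus_extD[OF assms(2)] by (auto simp: torus_shift_def fun_eq_iff)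

lemma torus_cball_sym:
  assumes "n \<ge> 1" "x \<in> torus d n" "y \<in> torus_cball d n x r"
  shows "x \<in> torus_cball d n y r"
proof -
  have y: "y \<in> torus d n" using assms(3) by (auto simp: torus_cball_def)
  obtain z where z: "z \<in> lattice_ball d r" "y = torus_shift d n x z"
    using assms torus_cball_eq by blast
  have "torus_shift d n y (\<lambda>i\<in>{..<d}. - z i) = x"
    using torus_coordD[OF assms(2)] torus_extD[OF assms(2)]
    by (auto simp: z(2) torus_shift_def fun_eq_iff mod_simps)
  moreover have "(\<lambda>i\<in>{..<d}. - z i) \<in> lattice_ball d r"
    using z(1) by (auto simp: lattice_ball_def)
  ultimately show ?thesis unfolding torus_cball_eq[OF assms(1) y] by (metis imageI)
qed

lemma torus_cball_triangle:
  assumes "n \<ge> 1" "x \<in> torus d n" "y \<in> torus_cball d n x r" "w \<in> torus_cball d n y s"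
  shows "w \<in> torus_cball d n x (r + s)"
proof -
  have y: "y \<in> torus d n" using assms(3) by (auto simp: torus_cball_def)
  obtain z where z: "z \<in> lattice_ball d r" "y = torus_shift d n x z"
    using assms torus_cball_eq by blast
  obtain u where u: "u \<in> lattice_ball d s" "w = torus_shift d n y u"
    using assms torus_cball_eq[OF assms(1) y] by blast
  have "(\<Sum>i<d. \<bar>z i + u i\<bar>) \<le> (\<Sum>i<d. \<bar>z i\<bar> + \<bar>u i\<bar>)" by (intro sum_mono) auto
  also have "\<dots> \<le> int (r + s)" using z(1) u(1) by (auto simp: lattice_ball_def sum.distrib)
  finally have "(\<lambda>i\<in>{..<d}. z i + u i) \<in> lattice_ball d (r + s)" by (auto simp: lattice_ball_def)
  moreover have "w = torus_shift d n x (\<lambda>i\<in>{..<d}. z i + u i)"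
    by (simp add: u(2) z(2) torus_shift_compose)
  ultimately show ?thesis unfolding torus_cball_eq[OF assms(1,2)] by blast
qed

lemma finite_lattice_ball: "finite (lattice_ball d r)"
proof (rule finite_subset)
  show "lattice_ball d r \<subseteq> {..<d} \<rightarrow>\<^sub>E {- int r..int r}"
  proof
    fix z assume z: "z \<in> lattice_ball d r"
    then show "z \<in> {..<d} \<rightarrow>\<^sub>E {- int r..int r}"
      using lattice_ball_coordD[OF z] by (force simp: lattice_ball_def PiE_iff abs_le_iff)
  qed
qed (auto intro!: finite_PiE)

lemma card_lattice_ball_0: "card (lattice_ball 0 r) = 1"
  by (simp add: lattice_ball_def)

text \<open>
  Slicing by the last coordinate \<open>a\<close>, which leaves the radius \<open>r - \<bar>a\<bar>\<close> for the others.
\<close>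

lemma card_lattice_ball_Suc:
  "card (lattice_ball (Suc d) r) = card (lattice_ball d r) + 2 * (\<Sum>s<r. card (lattice_ball d s))"
proof -
  have "bij_betw (\<lambda>(a, z). z(d := a)) (SIGMA a:{- int r..int r}. lattice_ball d (nat (int r - \<bar>a\<bar>)))
          (lattice_ball (Suc d) r)"
  proof (rule bij_betw_byWitness[where f' = "\<lambda>z. (z d, z(d := undefined))"], goal_cases)
    case 1
    then show ?case by (auto simp: lattice_ball_def PiE_iff extensional_def fun_eq_iff)
  next
    case 2
    then show ?case by auto
  next
    case 3
    have "(\<Sum>i<d. \<bar>z i\<bar>) + \<bar>a\<bar> \<le> int r"
      if "a \<in> {- int r..int r}" "z \<in> lattice_ball d (nat (int r - \<bar>a\<bar>))" for a z
      using that by (auto simp: lattice_ball_def abs_le_iff split: if_splits)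
    then show ?case by (auto simp: lattice_ball_def PiE_iff extensional_def)
  next
    case 4
    show ?case
    proof (intro subsetI, elim imageE, simp only:)
      fix z assume z: "z \<in> lattice_ball (Suc d) r"
      have "\<bar>z d\<bar> \<le> int r" using lattice_ball_coordD[OF z] by simp
      moreover have "(\<Sum>i<d. \<bar>z i\<bar>) \<le> int r - \<bar>z d\<bar>" using z by (simp add: lattice_ball_def)
      moreover have "z(d := undefined) \<in> {..<d} \<rightarrow>\<^sub>E UNIV"
        using z by (auto simp: lattice_ball_def PiE_iff extensional_def)
      ultimately show "(z d, z(d := undefined)) \<in>
          (SIGMA a:{- int r..int r}. lattice_ball d (nat (int r - \<bar>a\<bar>)))"
        by (simp add: lattice_ball_def abs_le_iff)
    qed
  qed
  then have "card (lattice_ball (Suc d) r) = card (SIGMA a:{- int r..int r}. lattice_ball d (nat (int r - \<bar>a\<bar>)))"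
    by (simp add: bij_betw_same_card)
  also have "\<dots> = (\<Sum>a\<in>{- int r..int r}. card (lattice_ball d (nat (int r - \<bar>a\<bar>))))"
    by (subst card_SigmaI) (auto simp: finite_lattice_ball)
  also have "{- int r..int r} = {0} \<union> (\<lambda>s. int r - int s) ` {..<r} \<union> (\<lambda>s. int s - int r) ` {..<r}"
  proof (intro equalityI subsetI)
    fix a assume "a \<in> {- int r..int r}"
    then consider "a = 0" | "a > 0" "a \<le> int r" | "a < 0" "- a \<le> int r" by fastforce
    then show "a \<in> {0} \<union> (\<lambda>s. int r - int s) ` {..<r} \<union> (\<lambda>s. int s - int r) ` {..<r}"
    proof cases
      case 2
      then have "a = int r - int (nat (int r - a))" "nat (int r - a) < r" by auto
      then show ?thesis by blast
    next
      case 3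
      then have "a = int (nat (int r + a)) - int r" "nat (int r + a) < r" by auto
      then show ?thesis by blast
    qed auto
  qed auto
  also have "(\<Sum>a\<in>\<dots>. card (lattice_ball d (nat (int r - \<bar>a\<bar>)))) =
      card (lattice_ball d r) + (\<Sum>s<r. card (lattice_ball d s)) + (\<Sum>s<r. card (lattice_ball d s))"
  proof -
    let ?f = "\<lambda>a. card (lattice_ball d (nat (int r - \<bar>a\<bar>)))"
    have "sum ?f ((\<lambda>s. int r - int s) ` {..<r}) = (\<Sum>s<r. card (lattice_ball d s))"
      by (subst sum.reindex) (auto simp: inj_on_def intro!: sum.cong)
    moreover have "sum ?f ((\<lambda>s. int s - int r) ` {..<r}) = (\<Sum>s<r. card (lattice_ball d s))"
      by (subst sum.reindex) (auto simp: inj_on_def intro!: sum.cong)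
    ultimately show ?thesis
      by (subst sum.union_disjoint; (subst sum.union_disjoint)?) auto
  qed
  finally show ?thesis by simp
qed

text \<open>
  The volume of a lattice ball is bounded on both sides by binomial coefficients that are
  asymptotic to \<open>2\<^sup>d r\<^sup>d / d!\<close>, and that can be summed over \<open>r\<close> in closed form.
\<close>

lemma card_lattice_ball_le: "card (lattice_ball d r) \<le> 2 ^ d * ((r + d) choose d)"
proof (induction d arbitrary: r)
  case 0
  then show ?case by (simp add: card_lattice_ball_0)
next
  case (Suc d)
  have "card (lattice_ball (Suc d) r) \<le> 2 * (\<Sum>s\<le>r. card (lattice_ball d s))"
    by (simp add: card_lattice_ball_Suc flip: lessThan_Suc_atMost)
  also have "\<dots> \<le> 2 * (\<Sum>s\<le>r. 2 ^ d * ((s + d) choose d))"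
    by (intro mult_left_mono sum_mono Suc) auto
  also have "\<dots> = 2 ^ Suc d * (\<Sum>s\<le>r. ((d + s) choose s))"
    by (simp add: sum_distrib_left binomial_symmetric[of d] add.commute mult.assoc)
  also have "(\<Sum>s\<le>r. ((d + s) choose s)) = (r + Suc d) choose Suc d"
    using sum_choose_lower[of d r] binomial_symmetric[of r "Suc d + r"] by (simp add: add.commute)
  finally show ?case .
qed

lemma sum_choose_lessThan: "(\<Sum>s<r. s choose d) = r choose Suc d"
  by (induction r) auto

lemma card_lattice_ball_ge: "card (lattice_ball d r) \<ge> 2 ^ d * (r choose d)"
proof (induction d arbitrary: r)
  case 0
  then show ?case by (simp add: card_lattice_ball_0)
next
  case (Suc d)
  have "2 ^ Suc d * (r choose Suc d) = 2 * (\<Sum>s<r. 2 ^ d * (s choose d))"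
    by (simp add: sum_choose_lessThan flip: sum_distrib_left)
  also have "\<dots> \<le> 2 * (\<Sum>s<r. card (lattice_ball d s))"
    by (intro mult_left_mono sum_mono Suc) auto
  also have "\<dots> \<le> card (lattice_ball (Suc d) r)" by (simp add: card_lattice_ball_Suc)
  finally show ?case .
qed

lemma card_torus_cball_le:
  assumes "n \<ge> 1" "x \<in> torus d n"
  shows "card (torus_cball d n x r) \<le> 2 ^ d * ((r + d) choose d)"
  unfolding torus_cball_eq[OF assms]
  using card_image_le[OF finite_lattice_ball] card_lattice_ball_le by (rule order_trans)

text \<open>
  As long as \<open>2 * r < n\<close>, a ball does not wrap around the torus.
\<close>

lemma card_torus_cball_ge:
  assumes "n \<ge> 1" "x \<in> torus d n" "2 * r < n"
  shows "card (torus_cball d n x r) \<ge> 2 ^ d * (r choose d)"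
proof -
  have "inj_on (torus_shift d n x) (lattice_ball d r)"
  proof (rule inj_onI)
    fix z w assume z: "z \<in> lattice_ball d r" and w: "w \<in> lattice_ball d r"
      and eq: "torus_shift d n x z = torus_shift d n x w"
    show "z = w"
    proof
      fix i
      show "z i = w i"
      proof (cases "i < d")
        case True
        have "(x i + z i) mod int n = (x i + w i) mod int n"
          using fun_cong[OF eq, of i] True by (simp add: torus_shift_def)
        then have "int n dvd z i - w i" by (simp add: mod_eq_dvd_iff)
        moreover have "\<bar>z i\<bar> \<le> int r" "\<bar>w i\<bar> \<le> int r"
          using lattice_ball_coordD z w True by auto
        then have "\<bar>z i - w i\<bar> < int n" using assms(3) by linarith
        ultimately show ?thesis using zdvd_imp_le[of "int n" "\<bar>z i - w i\<bar>"] by fastforce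
      next
        case False
        then show ?thesis using z w by (auto simp: lattice_ball_def PiE_iff extensional_def)
      qed
    qed
  qed
  then show ?thesis
    unfolding torus_cball_eq[OF assms(1,2)] by (simp add: card_image card_lattice_ball_ge)
qed

section \<open>Dense and separated grids in the torus\<close>

text \<open>
  The vectors whose coordinates are all among \<open>0, s, 2 * s, \<dots>, (m - 1) * s\<close>. With
  \<open>m = (n - 1) div s + 1\<close> these are all the multiples of \<open>s\<close> below \<open>n\<close>, and every vertex of the torus
  is close to one of them; with \<open>m = n div s\<close> the cyclic gap between the last and the first
  multiple is at least \<open>s\<close> too, so that distinct grid points are far apart.
\<close>

definition torus_grid :: "nat \<Rightarrow> nat \<Rightarrow> nat \<Rightarrow> (nat \<Rightarrow> int) set" where
  "torus_grid d s m = {..<d} \<rightarrow>\<^sub>E (\<lambda>a. int (s * a)) ` {..<m}"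

lemma finite_torus_grid: "finite (torus_grid d s m)"
  by (auto simp: torus_grid_def intro!: finite_PiE)

lemma card_torus_grid: "s \<ge> 1 \<Longrightarrow> card (torus_grid d s m) = m ^ d"
  by (simp add: torus_grid_def card_PiE card_image inj_on_def)

lemma torus_grid_subset:
  assumes "\<And>a. a < m \<Longrightarrow> s * a < n"
  shows "torus_grid d s m \<subseteq> torus d n"
  unfolding torus_grid_def torus_def
  by (intro PiE_mono) (use assms in \<open>auto simp flip: of_nat_mult\<close>)

lemma dense_grid_subset:
  assumes "n \<ge> 1"
  shows "torus_grid d s ((n - 1) div s + 1) \<subseteq> torus d n"
proof (rule torus_grid_subset)
  fix a assume "a < (n - 1) div s + 1"
  then have "s * a \<le> s * ((n - 1) div s)" by (intro mult_left_mono) auto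
  also have "\<dots> \<le> n - 1" by simp
  finally show "s * a < n" using assms by linarith
qed

lemma dense_grid:
  assumes "n \<ge> 1" "s \<ge> 1" "v \<in> torus d n"
  shows "\<exists>u\<in>torus_grid d s ((n - 1) div s + 1). u \<in> torus_cball d n v (d * s)"
proof -
  \<comment> \<open>Round every coordinate down to a multiple of \<open>s\<close>.\<close>
  define u where "u = (\<lambda>i\<in>{..<d}. int (s * (nat (v i) div s)))"
  have u: "u \<in> torus_grid d s ((n - 1) div s + 1)"
    unfolding torus_grid_def
  proof (rule PiE_I)
    fix i assume i: "i \<in> {..<d}"
    then have "nat (v i) \<le> n - 1" using torus_coordD[OF assms(3), of i] by auto
    then have "nat (v i) div s \<le> (n - 1) div s" by (rule div_le_mono)
    then show "u i \<in> (\<lambda>a. int (s * a)) ` {..<(n - 1) div s + 1}"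
      using i by (auto simp: u_def simp del: of_nat_mult)
  qed (auto simp: u_def)
  then have ut: "u \<in> torus d n" using dense_grid_subset assms(1) by blast
  have "\<bar>u i - v i\<bar> \<le> int s" if i: "i < d" for i
  proof -
    have "v i = int (nat (v i))" using torus_coordD[OF assms(3) i] by simp
    also have "\<dots> = int (s * (nat (v i) div s)) + int (nat (v i) mod s)"
      by (metis mult_div_mod_eq of_nat_add)
    finally have "u i - v i = - int (nat (v i) mod s)" using i by (simp add: u_def)
    moreover have "nat (v i) mod s \<le> s" using assms(2) by (simp add: less_imp_le)
    ultimately show ?thesis by simp
  qed
  then have "(\<Sum>i<d. \<bar>u i - v i\<bar>) \<le> (\<Sum>i<d. int s)" by (intro sum_mono) auto
  then have "(\<lambda>i\<in>{..<d}. u i - v i) \<in> lattice_ball d (d * s)" by (simp add: lattice_ball_def)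
  then have "u \<in> torus_cball d n v (d * s)"
    unfolding torus_cball_eq[OF assms(1,3)] using torus_shift_self[OF assms(3) ut] by (metis imageI)
  with u show ?thesis by blast
qed

lemma separated_grid_subset:
  assumes "s \<ge> 1"
  shows "torus_grid d s (n div s) \<subseteq> torus d n"
proof (rule torus_grid_subset)
  fix a assume "a < n div s"
  then have "s * (a + 1) \<le> s * (n div s)" by (intro mult_left_mono) auto
  also have "\<dots> \<le> n" by simp
  finally show "s * a < n" using assms by simp
qed

lemma separated_grid_disjoint:
  assumes "n \<ge> 1" "2 * r < s" "u \<in> torus_grid d s (n div s)" "v \<in> torus_grid d s (n div s)" "u \<noteq> v"
  shows "torus_cball d n u r \<inter> torus_cball d n v r = {}"
proof (rule ccontr)
  assume "torus_cball d n u r \<inter> torus_cball d n v r \<noteq> {}"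
  then obtain y where y: "y \<in> torus_cball d n u r" "y \<in> torus_cball d n v r" by blast
  have s: "s \<ge> 1" using assms(2) by simp
  have u: "u \<in> torus d n" and v: "v \<in> torus d n"
    using assms(3,4) separated_grid_subset[OF s] by blast+
  have "v \<in> torus_cball d n u (r + r)"
    using torus_cball_triangle[OF assms(1) u y(1) torus_cball_sym[OF assms(1) v y(2)]] .
  then obtain z where z: "z \<in> lattice_ball d (r + r)" "v = torus_shift d n u z"
    unfolding torus_cball_eq[OF assms(1) u] by blast
  obtain i where i: "i < d" "u i \<noteq> v i"
    using \<open>u \<noteq> v\<close> torus_extD[OF u] torus_extD[OF v] by (metis ext)
  obtain a b where ab: "u i = int (s * a)" "v i = int (s * b)" "a < n div s" "b < n div s"
  proof -
    have "u i \<in> (\<lambda>a. int (s * a)) ` {..<n div s}" "v i \<in> (\<lambda>a. int (s * a)) ` {..<n div s}"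
      using assms(3,4) i(1) by (auto simp: torus_grid_def)
    then show ?thesis using that by blast
  qed
  have "\<bar>z i\<bar> \<le> int (r + r)" using lattice_ball_coordD[OF z(1) i(1)] .
  then have zs: "\<bar>z i\<bar> < int s" using assms(2) by linarith
  have "int (s * b) = (int (s * a) + z i) mod int n"
    using ab z(2) i(1) by (simp add: torus_shift_def)
  then have "(int (s * b) - int (s * a)) mod int n = z i mod int n"
    by (simp add: mod_simps del: of_nat_mult)
  then have "int n dvd (int (s * b) - int (s * a)) - z i" by (simp add: mod_eq_dvd_iff)
  then obtain q where q: "int (s * b) - int (s * a) - z i = int n * q" by (elim dvdE)
  define c where "c = int b - int a"
  have c: "c \<noteq> 0" using i(2) ab by (auto simp: c_def)
  have q': "int s * c - z i = int n * q" using q by (simp add: c_def algebra_simps)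
  have "\<bar>c\<bar> \<le> int (n div s) - 1" using ab(3,4) by (auto simp: c_def)
  then have "int s * \<bar>c\<bar> \<le> int s * (int (n div s) - 1)" by (intro mult_left_mono) auto
  also have "\<dots> = int (s * (n div s)) - int s" by (simp add: algebra_simps)
  also have "\<dots> \<le> int n - int s" by (simp only: diff_right_mono of_nat_le_iff times_div_less_eq_dividend)
  finally have up: "\<bar>int s * c\<bar> \<le> int n - int s" by (simp add: abs_mult)
  have "int s * 1 \<le> int s * \<bar>c\<bar>" using c by (intro mult_left_mono) auto
  then have lo: "\<bar>int s * c\<bar> \<ge> int s" by (simp add: abs_mult)
  \<comment> \<open>\<open>z i\<close> differs from \<open>s * c\<close>, where \<open>s \<le> \<bar>s * c\<bar> \<le> n - s\<close>, by a multiple of \<open>n\<close>, so it is at least \<open>s\<close>.\<close>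
  show False
  proof (cases "q = 0")
    case True
    then show False using lo zs q' by simp
  next
    case False
    then have "int n * 1 \<le> int n * \<bar>q\<bar>" by (intro mult_left_mono) auto
    then have "int n \<le> \<bar>int n * q\<bar>" by (simp add: abs_mult)
    then show False using up zs q' by linarith
  qed
qed

section \<open>Uncovered vertices\<close>

lemma cc_time_le_iff:
  assumes "\<And>i. i \<ge> 1 \<Longrightarrow> x i \<in> torus d n"
  shows "cc_time d n x \<le> k \<longleftrightarrow> (\<forall>v\<in>torus d n. \<exists>i\<in>{1..k}. v \<in> torus_cball d n (x i) (k - i))"
proof -
  define C where "C = {k. (\<Union>i\<in>{1..k}. torus_cball d n (x i) (k - i)) = torus d n}"
  have C: "k \<in> C \<longleftrightarrow> (\<forall>v\<in>torus d n. \<exists>i\<in>{1..k}. v \<in> torus_cball d n (x i) (k - i))" for k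
    unfolding C_def using torus_cball_subset by fast
  have up: "k \<in> C" if lC: "l \<in> C" and lk: "l \<le> k" for k l
    unfolding C
  proof
    fix v assume "v \<in> torus d n"
    then obtain i where i: "i \<in> {1..l}" "v \<in> torus_cball d n (x i) (l - i)" using lC[unfolded C] by blast
    then have "v \<in> torus_cball d n (x i) (k - i)"
      using torus_cball_mono[OF diff_le_mono[OF lk], of d n "x i" i] by blast
    moreover have "i \<in> {1..k}" using i(1) lk by simp
    ultimately show "\<exists>i\<in>{1..k}. v \<in> torus_cball d n (x i) (k - i)" by blast
  qed
  \<comment> \<open>The ball around \<open>x 1\<close> eventually covers everything, so the infimum is a minimum.\<close>
  define D where "D = Max (torus_dist d n (x 1) ` torus d n)"
  have "torus_dist d n (x 1) v \<le> D" if "v \<in> torus d n" for v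
    unfolding D_def using that finite_torus by (intro Max_ge) auto
  then have "Suc D \<in> C" unfolding C by (auto simp: torus_cball_def intro!: bexI[of _ 1])
  then have "Inf C \<in> C" by (intro Inf_nat_def1) auto
  then have "Inf C \<le> k \<longleftrightarrow> k \<in> C"
    using up by (auto intro: cInf_lower)
  then show ?thesis unfolding C by (simp add: cc_time_def C_def)
qed

text \<open>
  If \<open>v\<close> is uncovered at time \<open>k\<close>, then the whole ball of radius \<open>j\<close> around \<open>v\<close> was uncovered at
  time \<open>k - j\<close>, because the balls grow by one at each step. This is what allows the union bound to
  run over a sparse grid.
\<close>

lemma missed_earlier:
  assumes "n \<ge> 1" "v \<in> torus d n" "u \<in> torus_cball d n v j" "\<And>i. i \<ge> 1 \<Longrightarrow> x i \<in> torus d n"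
    and missed: "\<forall>i\<in>{1..k}. v \<notin> torus_cball d n (x i) (k - i)"
  shows "\<forall>i\<in>{1..k - j}. u \<notin> torus_cball d n (x i) (k - j - i)"
proof (intro ballI notI)
  fix i assume i: "i \<in> {1..k - j}" and u: "u \<in> torus_cball d n (x i) (k - j - i)"
  have "v \<in> torus_cball d n u j" using torus_cball_sym[OF assms(1-3)] .
  then have "v \<in> torus_cball d n (x i) (k - j - i + j)"
    using torus_cball_triangle[OF assms(1) assms(4) u] i by auto
  moreover have "k - j - i + j = k - i" using i by auto
  ultimately show False using missed i by auto
qed

section \<open>The second moment method\<close>

text \<open>
  For pairwise negatively correlated events, the number \<open>Z\<close> of events that occur has variance at
  most its mean \<open>\<mu>\<close>, so that \<open>\<mu>\<^sup>2\<close> times the probability of \<open>Z = 0\<close> is at most \<open>\<mu>\<close>. The conclusion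
  avoids a division and so holds for \<open>\<mu> = 0\<close> as well.
\<close>

lemma (in prob_space) second_moment_avoidance:
  assumes "finite S" and A: "\<And>v. v \<in> S \<Longrightarrow> A v \<in> events"
    and neg: "\<And>u v. u \<in> S \<Longrightarrow> v \<in> S \<Longrightarrow> u \<noteq> v \<Longrightarrow> prob (A u \<inter> A v) \<le> prob (A u) * prob (A v)"
  shows "prob (space M - (\<Union>v\<in>S. A v)) * (\<Sum>v\<in>S. prob (A v)) \<le> 1"
proof -
  define \<mu> where "\<mu> = (\<Sum>v\<in>S. prob (A v))"
  define E where "E = space M - (\<Union>v\<in>S. A v)"
  define Z where "Z = (\<lambda>\<omega>. \<Sum>v\<in>S. indicator (A v) \<omega> :: real)"
  have E: "E \<in> events" unfolding E_def using assms(1) A by auto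
  have int: "integrable M (indicator B :: 'a \<Rightarrow> real)" if "B \<in> events" for B
    using that by (auto intro!: integrable_real_indicator simp: emeasure_eq_measure)
  have Z2: "(Z \<omega> - \<mu>)\<^sup>2 = (\<Sum>u\<in>S. \<Sum>v\<in>S. indicator (A u \<inter> A v) \<omega>) - 2 * \<mu> * (\<Sum>v\<in>S. indicator (A v) \<omega>) + \<mu>\<^sup>2"
    for \<omega>
    by (simp add: Z_def power2_eq_square sum_product indicator_inter_arith algebra_simps)
  have int_uv: "integrable M (indicator (A u \<inter> A v) :: 'a \<Rightarrow> real)" if "u \<in> S" "v \<in> S" for u v
    using that A by (intro int) auto
  have int_v: "integrable M (indicator (A v) :: 'a \<Rightarrow> real)" if "v \<in> S" for v
    using that A by (intro int) auto
  have intZ: "integrable M (\<lambda>\<omega>. (Z \<omega> - \<mu>)\<^sup>2)"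
    unfolding Z2 by (intro Bochner_Integration.integrable_add Bochner_Integration.integrable_diff
      Bochner_Integration.integrable_sum integrable_mult_right int_uv int_v) auto
  have "\<mu>\<^sup>2 * prob E = (\<integral>\<omega>. \<mu>\<^sup>2 * indicator E \<omega> \<partial>M)"
    using E by simp
  also have "\<dots> \<le> (\<integral>\<omega>. (Z \<omega> - \<mu>)\<^sup>2 \<partial>M)"
  proof (intro integral_mono intZ integrable_mult_right int E)
    fix \<omega>
    show "\<mu>\<^sup>2 * indicator E \<omega> \<le> (Z \<omega> - \<mu>)\<^sup>2"
      by (auto simp: indicator_def Z_def E_def split: if_splits intro!: sum.neutral)
  qed
  also have "\<dots> = (\<Sum>u\<in>S. \<Sum>v\<in>S. prob (A u \<inter> A v)) - 2 * \<mu> * (\<Sum>v\<in>S. prob (A v)) + \<mu>\<^sup>2"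
  proof -
    have 1: "(\<integral>\<omega>. (\<Sum>u\<in>S. \<Sum>v\<in>S. indicator (A u \<inter> A v) \<omega>) \<partial>M) = (\<Sum>u\<in>S. \<Sum>v\<in>S. prob (A u \<inter> A v))"
      using A by (subst Bochner_Integration.integral_sum; (intro Bochner_Integration.integrable_sum int_uv sum.cong refl)?)
        (auto simp: Bochner_Integration.integral_sum int_uv intro!: sum.cong)
    have 2: "(\<integral>\<omega>. (\<Sum>v\<in>S. indicator (A v) \<omega>) \<partial>M) = (\<Sum>v\<in>S. prob (A v))"
      using A by (subst Bochner_Integration.integral_sum) (auto simp: int_v intro!: sum.cong)
    have i1: "integrable M (\<lambda>\<omega>. (\<Sum>u\<in>S. \<Sum>v\<in>S. indicator (A u \<inter> A v) \<omega> :: real))"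
      by (intro Bochner_Integration.integrable_sum int_uv)
    have i2: "integrable M (\<lambda>\<omega>. 2 * \<mu> * (\<Sum>v\<in>S. indicator (A v) \<omega> :: real))"
      by (intro integrable_mult_right Bochner_Integration.integrable_sum int_v)
    show ?thesis unfolding Z2
      using i1 i2 1 2 by (simp add: prob_space)
  qed
  also have "\<dots> \<le> (\<Sum>u\<in>S. prob (A u) + (\<Sum>v\<in>S. prob (A u) * prob (A v))) - 2 * \<mu> * \<mu> + \<mu>\<^sup>2"
  proof -
    have "(\<Sum>v\<in>S. prob (A u \<inter> A v)) \<le> prob (A u) + (\<Sum>v\<in>S. prob (A u) * prob (A v))"
      if u: "u \<in> S" for u
    proof -
      have "(\<Sum>v\<in>S. prob (A u \<inter> A v)) = prob (A u) + (\<Sum>v\<in>S - {u}. prob (A u \<inter> A v))"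
        using u assms(1) by (subst sum.remove[of _ u]) auto
      also have "(\<Sum>v\<in>S - {u}. prob (A u \<inter> A v)) \<le> (\<Sum>v\<in>S - {u}. prob (A u) * prob (A v))"
        using neg u by (intro sum_mono) auto
      also have "\<dots> \<le> (\<Sum>v\<in>S. prob (A u) * prob (A v))"
        using assms(1) by (intro sum_mono2) auto
      finally show ?thesis by simp
    qed
    then show ?thesis unfolding \<mu>_def by (intro add_right_mono diff_right_mono sum_mono) auto
  qed
  also have "\<dots> = \<mu>"
    by (simp add: sum.distrib \<mu>_def power2_eq_square sum_product)
  finally have *: "\<mu>\<^sup>2 * prob E \<le> \<mu>" .
  have "\<mu> \<ge> 0" unfolding \<mu>_def by (intro sum_nonneg) auto
  then have "prob E * \<mu> \<le> 1"
    using * by (cases "\<mu> = 0") (auto simp: power2_eq_square mult.assoc mult.commute)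
  then show ?thesis by (simp add: E_def \<mu>_def)
qed

section \<open>Probability bounds for the covering time\<close>

lemma exp_neg_le_one_minus:
  fixes x \<eta> :: real
  assumes "0 \<le> x" "x \<le> \<eta>" "\<eta> < 1"
  shows "exp (- x / (1 - \<eta>)) \<le> 1 - x"
proof -
  have "1 / (1 - x) = 1 + x / (1 - x)" using assms by (simp add: field_simps)
  also have "\<dots> \<le> 1 + x / (1 - \<eta>)" using assms by (intro add_left_mono divide_left_mono) auto
  also have "\<dots> \<le> exp (x / (1 - \<eta>))" by (rule exp_ge_add_one_self)
  finally have "1 / exp (x / (1 - \<eta>)) \<le> 1 - x" using assms by (simp add: field_simps)
  then show ?thesis by (simp add: exp_minus inverse_eq_divide)
qed

lemma sum_choose_add_lessThan: "(\<Sum>r<k. (r + d) choose d) \<le> (k + d) choose Suc d"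
  by (induction k) auto

text \<open>
  Independent uniform vertices \<open>X 1, X 2, \<dots>\<close> of the torus; \<open>X 0\<close> is irrelevant.
\<close>

locale uniform_torus_sequence = prob_space M for M :: "'a measure" +
  fixes d n :: nat and X :: "nat \<Rightarrow> 'a \<Rightarrow> nat \<Rightarrow> int"
  assumes n_pos: "n \<ge> 1"
    and indep: "indep_vars (\<lambda>_. count_space (torus d n)) X {1..}"
    and unif: "\<And>i. i \<ge> 1 \<Longrightarrow> distr M (count_space (torus d n)) (X i) = uniform_count_measure (torus d n)"
begin

lemma X_meas: "i \<ge> 1 \<Longrightarrow> X i \<in> M \<rightarrow>\<^sub>M count_space (torus d n)"
  using indep by (auto simp: indep_vars_def)

lemma X_torus: "i \<ge> 1 \<Longrightarrow> \<omega> \<in> space M \<Longrightarrow> X i \<omega> \<in> torus d n"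
  using measurable_space[OF X_meas] by auto

lemma vimage_events: "i \<ge> 1 \<Longrightarrow> A \<subseteq> torus d n \<Longrightarrow> X i -` A \<inter> space M \<in> events"
  using measurable_sets[OF X_meas] by auto

lemma prob_vimage:
  assumes "i \<ge> 1" "A \<subseteq> torus d n"
  shows "prob (X i -` A \<inter> space M) = card A / real n ^ d"
proof -
  have "prob (X i -` A \<inter> space M) = measure (distr M (count_space (torus d n)) (X i)) A"
    using assms by (subst measure_distr) (auto simp: X_meas)
  also have "\<dots> = card A / card (torus d n)"
    using assms by (simp add: unif measure_uniform_count_measure finite_torus)
  finally show ?thesis by (simp add: card_torus)
qed

lemma avoid_eq:
  "{\<omega> \<in> space M. \<forall>i\<in>{1..k}. X i \<omega> \<notin> A i} =
     space M \<inter> (\<Inter>i\<in>{1..k}. X i -` (torus d n - A i) \<inter> space M)" if "k \<ge> 1"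
  using that X_torus by auto

lemma avoid_events: "{\<omega> \<in> space M. \<forall>i\<in>{1..k}. X i \<omega> \<notin> A i} \<in> events"
proof (cases "k \<ge> 1")
  case True
  show ?thesis unfolding avoid_eq[OF True]
    using True by (intro sets.Int sets.finite_INT vimage_events) auto
qed simp

lemma prob_avoid:
  assumes "\<And>i. i \<in> {1..k} \<Longrightarrow> A i \<subseteq> torus d n"
  shows "prob {\<omega> \<in> space M. \<forall>i\<in>{1..k}. X i \<omega> \<notin> A i} = (\<Prod>i\<in>{1..k}. 1 - card (A i) / real n ^ d)"
proof (cases "k \<ge> 1")
  case True
  have "prob (\<Inter>i\<in>{1..k}. X i -` (torus d n - A i) \<inter> space M) =
      (\<Prod>i\<in>{1..k}. prob (X i -` (torus d n - A i) \<inter> space M))"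
    using True by (intro indep_varsD[OF indep]) auto
  also have "\<dots> = (\<Prod>i\<in>{1..k}. 1 - card (A i) / real n ^ d)"
  proof (intro prod.cong refl)
    fix i assume i: "i \<in> {1..k}"
    have "card (A i) \<le> card (torus d n)"
      using assms[OF i] by (intro card_mono finite_torus)
    moreover have "card (torus d n - A i) = card (torus d n) - card (A i)"
      using assms[OF i] finite_torus by (intro card_Diff_subset) (auto intro: finite_subset)
    ultimately show "prob (X i -` (torus d n - A i) \<inter> space M) = 1 - card (A i) / real n ^ d"
      using i n_pos by (simp add: prob_vimage card_torus of_nat_diff field_simps)
  qed
  also have "(\<Inter>i\<in>{1..k}. X i -` (torus d n - A i) \<inter> space M) =
      space M \<inter> (\<Inter>i\<in>{1..k}. X i -` (torus d n - A i) \<inter> space M)" using True by auto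
  finally show ?thesis unfolding avoid_eq[OF True] .
qed (simp add: prob_space)

text \<open>
  The event that \<open>v\<close> is still uncovered at time \<open>k\<close>.
\<close>

definition missed :: "nat \<Rightarrow> (nat \<Rightarrow> int) \<Rightarrow> 'a set" where
  "missed k v = {\<omega> \<in> space M. \<forall>i\<in>{1..k}. v \<notin> torus_cball d n (X i \<omega>) (k - i)}"

text \<open>
  By symmetry of the metric, the event \<open>missed k v\<close> says that each \<open>X i\<close> avoids a fixed set.
\<close>

lemma missed_eq:
  assumes "v \<in> torus d n"
  shows "missed k v = {\<omega> \<in> space M. \<forall>i\<in>{1..k}. X i \<omega> \<notin> torus_cball d n v (k - i)}"
  unfolding missed_def
  using torus_cball_sym[OF n_pos assms] torus_cball_sym[OF n_pos X_torus] by fastforce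

lemma missed_events: "v \<in> torus d n \<Longrightarrow> missed k v \<in> events"
  by (simp only: missed_eq avoid_events)

lemma cball_frac_le_1: "card (torus_cball d n v r) / real n ^ d \<le> 1"
proof -
  have "card (torus_cball d n v r) \<le> n ^ d"
    using card_mono[OF finite_torus torus_cball_subset] card_torus by metis
  then have "real (card (torus_cball d n v r)) \<le> real n ^ d"
    by (simp only: of_nat_power [symmetric] of_nat_le_iff)
  then show ?thesis using n_pos by simp
qed

lemma prod_reverse: "(\<Prod>i\<in>{1..k}. f (k - i)) = (\<Prod>r<k. f r)" for f :: "nat \<Rightarrow> real"
  by (rule prod.reindex_bij_witness[where i = "\<lambda>r. k - r" and j = "\<lambda>i. k - i"]) auto

lemma prob_missed:
  assumes "v \<in> torus d n"
  shows "prob (missed k v) = (\<Prod>r<k. 1 - card (torus_cball d n v r) / real n ^ d)"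
proof -
  have "prob (missed k v) = (\<Prod>i\<in>{1..k}. 1 - card (torus_cball d n v (k - i)) / real n ^ d)"
    unfolding missed_eq[OF assms] by (intro prob_avoid torus_cball_subset)
  also have "\<dots> = (\<Prod>r<k. 1 - card (torus_cball d n v r) / real n ^ d)"
    by (rule prod_reverse)
  finally show ?thesis .
qed

lemma prob_missed_le:
  assumes "v \<in> torus d n" "2 * k \<le> n"
  shows "prob (missed k v) \<le> exp (- (2 ^ d * real (k choose Suc d) / real n ^ d))"
proof -
  have "prob (missed k v) \<le> (\<Prod>r<k. exp (- (2 ^ d * real (r choose d) / real n ^ d)))"
    unfolding prob_missed[OF assms(1)]
  proof (intro prod_mono conjI)
    fix r assume r: "r \<in> {..<k}"
    show "0 \<le> 1 - card (torus_cball d n v r) / real n ^ d" using cball_frac_le_1 by simp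
    have "real (2 ^ d * (r choose d)) \<le> real (card (torus_cball d n v r))"
      using r assms by (intro of_nat_mono card_torus_cball_ge n_pos) auto
    then have "2 ^ d * real (r choose d) / real n ^ d \<le> card (torus_cball d n v r) / real n ^ d"
      by (intro divide_right_mono) auto
    then have "1 - card (torus_cball d n v r) / real n ^ d \<le> 1 + - (2 ^ d * real (r choose d) / real n ^ d)"
      by simp
    also have "\<dots> \<le> exp (- (2 ^ d * real (r choose d) / real n ^ d))" by (rule exp_ge_add_one_self)
    finally show "1 - card (torus_cball d n v r) / real n ^ d \<le> exp (- (2 ^ d * real (r choose d) / real n ^ d))" .
  qed
  also have "\<dots> = exp (- (2 ^ d * real (\<Sum>r<k. r choose d) / real n ^ d))"
    by (simp add: sum_negf sum_distrib_left sum_divide_distrib flip: exp_sum)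
  finally show ?thesis by (simp only: sum_choose_lessThan)
qed

lemma prob_missed_ge:
  assumes "v \<in> torus d n" "0 \<le> \<eta>" "\<eta> < 1" "2 ^ d * real ((k + d) choose d) / real n ^ d \<le> \<eta>"
  shows "prob (missed k v) \<ge> exp (- (2 ^ d * real ((k + d) choose Suc d) / real n ^ d) / (1 - \<eta>))"
proof -
  have "exp (- (2 ^ d * real ((k + d) choose Suc d) / real n ^ d) / (1 - \<eta>)) \<le>
      exp (- (2 ^ d * real (\<Sum>r<k. (r + d) choose d) / real n ^ d) / (1 - \<eta>))"
    using sum_choose_add_lessThan[of d k] assms(3)
    by (auto intro!: divide_right_mono mult_left_mono simp del: of_nat_sum)
  also have "\<dots> = (\<Prod>r<k. exp (- (2 ^ d * real ((r + d) choose d) / real n ^ d) / (1 - \<eta>)))"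
    by (simp add: sum_negf sum_distrib_left sum_divide_distrib flip: exp_sum)
  also have "\<dots> \<le> prob (missed k v)"
    unfolding prob_missed[OF assms(1)]
  proof (intro prod_mono conjI)
    fix r assume r: "r \<in> {..<k}"
    define x where "x = 2 ^ d * real ((r + d) choose d) / real n ^ d"
    have "real ((r + d) choose d) \<le> real ((k + d) choose d)"
      using r by (intro of_nat_mono binomial_right_mono) auto
    then have "x \<le> 2 ^ d * real ((k + d) choose d) / real n ^ d"
      unfolding x_def by (intro divide_right_mono mult_left_mono) auto
    then have "exp (- x / (1 - \<eta>)) \<le> 1 - x"
      using assms by (intro exp_neg_le_one_minus) (auto simp: x_def)
    also have "real (card (torus_cball d n v r)) \<le> real (2 ^ d * ((r + d) choose d))"
      using assms by (intro of_nat_mono card_torus_cball_le n_pos)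
    then have "1 - x \<le> 1 - card (torus_cball d n v r) / real n ^ d"
      unfolding x_def by (intro diff_left_mono divide_right_mono) auto
    finally show "exp (- (2 ^ d * real ((r + d) choose d) / real n ^ d) / (1 - \<eta>)) \<le>
        1 - card (torus_cball d n v r) / real n ^ d" by (simp add: x_def)
  qed auto
  finally show ?thesis .
qed

lemma cc_time_le_eq:
  "{\<omega> \<in> space M. cc_time d n (\<lambda>i. X i \<omega>) \<le> k} = space M - (\<Union>v\<in>torus d n. missed k v)"
proof -
  have "cc_time d n (\<lambda>i. X i \<omega>) \<le> k \<longleftrightarrow>
      (\<forall>v\<in>torus d n. \<exists>i\<in>{1..k}. v \<in> torus_cball d n (X i \<omega>) (k - i))" if "\<omega> \<in> space M" for \<omega>
    using that X_torus by (intro cc_time_le_iff)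
  then show ?thesis by (auto simp: missed_def)
qed

text \<open>
  The predicate \<open>Q\<close> is arbitrary because the covering time has values in a countable set.
\<close>

lemma cc_time_events: "{\<omega> \<in> space M. Q (cc_time d n (\<lambda>i. X i \<omega>))} \<in> events"
proof -
  define L where "L k = {\<omega> \<in> space M. cc_time d n (\<lambda>i. X i \<omega>) \<le> k}" for k
  have L: "L k \<in> events" for k
    unfolding L_def cc_time_le_eq by (intro sets.Diff sets.top sets.finite_UN finite_torus missed_events)
  have "{\<omega> \<in> space M. Q (cc_time d n (\<lambda>i. X i \<omega>))} = (\<Union>k\<in>{k. Q k}. L k - (\<Union>j<k. L j))"
  proof (intro equalityI subsetI)
    fix \<omega> assume "\<omega> \<in> {\<omega> \<in> space M. Q (cc_time d n (\<lambda>i. X i \<omega>))}"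
    then show "\<omega> \<in> (\<Union>k\<in>{k. Q k}. L k - (\<Union>j<k. L j))"
      by (intro UN_I[of "cc_time d n (\<lambda>i. X i \<omega>)"]) (auto simp: L_def)
  next
    fix \<omega> assume "\<omega> \<in> (\<Union>k\<in>{k. Q k}. L k - (\<Union>j<k. L j))"
    then obtain k where k: "Q k" "\<omega> \<in> L k" "\<omega> \<notin> (\<Union>j<k. L j)" by blast
    then have "cc_time d n (\<lambda>i. X i \<omega>) = k"
      by (auto simp: L_def)
    then show "\<omega> \<in> {\<omega> \<in> space M. Q (cc_time d n (\<lambda>i. X i \<omega>))}"
      using k by (auto simp: L_def)
  qed
  also have "\<dots> \<in> events"
  proof (rule sets.countable_UN')
    show "countable {k. Q k}" by (rule countableI_type)
    have "L k - (\<Union>j<k. L j) \<in> events" for k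
      by (intro sets.Diff L sets.finite_UN) auto
    then show "(\<lambda>k. L k - (\<Union>j<k. L j)) ` {k. Q k} \<subseteq> events" by blast
  qed
  finally show ?thesis .
qed

text \<open>
  Union bound over a grid of spacing \<open>s\<close> at the time \<open>k - d * s\<close>.
\<close>

lemma prob_cc_time_gt:
  assumes "s \<ge> 1" "d * s \<le> k" "2 * (k - d * s) \<le> n"
  shows "prob {\<omega> \<in> space M. cc_time d n (\<lambda>i. X i \<omega>) > k} \<le>
    (real n / real s + 1) ^ d * exp (- (2 ^ d * real ((k - d * s) choose Suc d) / real n ^ d))"
proof -
  define G where "G = torus_grid d s ((n - 1) div s + 1)"
  define p where "p = exp (- (2 ^ d * real ((k - d * s) choose Suc d) / real n ^ d))"
  have G: "G \<subseteq> torus d n" unfolding G_def using dense_grid_subset[OF n_pos] .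
  have "{\<omega> \<in> space M. cc_time d n (\<lambda>i. X i \<omega>) > k} \<subseteq> (\<Union>u\<in>G. missed (k - d * s) u)"
  proof
    fix \<omega> assume "\<omega> \<in> {\<omega> \<in> space M. cc_time d n (\<lambda>i. X i \<omega>) > k}"
    then have \<omega>: "\<omega> \<in> space M" and "\<omega> \<notin> {\<omega> \<in> space M. cc_time d n (\<lambda>i. X i \<omega>) \<le> k}" by auto
    then obtain v where v: "v \<in> torus d n" "\<omega> \<in> missed k v" unfolding cc_time_le_eq by blast
    then obtain u where u: "u \<in> G" "u \<in> torus_cball d n v (d * s)"
      using dense_grid[OF n_pos assms(1) v(1)] unfolding G_def by blast
    have "\<omega> \<in> missed (k - d * s) u"
      using missed_earlier[OF n_pos v(1) u(2), of "\<lambda>i. X i \<omega>" k] v(2) X_torus \<omega>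
      by (auto simp: missed_def)
    with u show "\<omega> \<in> (\<Union>u\<in>G. missed (k - d * s) u)" by blast
  qed
  then have "prob {\<omega> \<in> space M. cc_time d n (\<lambda>i. X i \<omega>) > k} \<le> prob (\<Union>u\<in>G. missed (k - d * s) u)"
    using G by (intro finite_measure_mono sets.finite_UN missed_events)
      (auto simp: G_def finite_torus_grid)
  also have "\<dots> \<le> (\<Sum>u\<in>G. prob (missed (k - d * s) u))"
    using G missed_events by (intro finite_measure_subadditive_finite) (auto simp: G_def finite_torus_grid)
  also have "\<dots> \<le> (\<Sum>u\<in>G. p)"
    unfolding p_def using G assms by (intro sum_mono prob_missed_le) auto
  also have "\<dots> = real ((n - 1) div s + 1) ^ d * p"
    using assms(1) by (simp add: G_def card_torus_grid)
  also have "\<dots> \<le> (real n / real s + 1) ^ d * p"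
  proof (intro mult_right_mono power_mono)
    have "real ((n - 1) div s) \<le> real (n - 1) / real s" by (rule of_nat_div_le_of_nat)
    also have "\<dots> \<le> real n / real s" by (intro divide_right_mono) auto
    finally show "real ((n - 1) div s + 1) \<le> real n / real s + 1" by simp
  qed (auto simp: p_def)
  finally show ?thesis by (simp add: p_def)
qed

text \<open>
  Disjoint balls are hit with a probability that is the sum of their measures, and
  \<open>1 - a - b \<le> (1 - a) * (1 - b)\<close>: far apart vertices are negatively correlated.
\<close>

lemma prob_missed_both:
  assumes "u \<in> torus d n" "v \<in> torus d n" "torus_cball d n u k \<inter> torus_cball d n v k = {}"
  shows "prob (missed k u \<inter> missed k v) \<le> prob (missed k u) * prob (missed k v)"
proof -
  define a where "a = (\<lambda>w r. card (torus_cball d n w r) / real n ^ d)"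
  have card_un: "card (torus_cball d n u (k - i) \<union> torus_cball d n v (k - i)) =
      card (torus_cball d n u (k - i)) + card (torus_cball d n v (k - i))" for i
  proof (rule card_Un_disjoint)
    show "torus_cball d n u (k - i) \<inter> torus_cball d n v (k - i) = {}"
      using assms(3) torus_cball_mono[OF diff_le_self[of k i], of d n u]
        torus_cball_mono[OF diff_le_self[of k i], of d n v] by blast
  qed (rule finite_subset[OF torus_cball_subset finite_torus])+
  have both: "missed k u \<inter> missed k v =
      {\<omega> \<in> space M. \<forall>i\<in>{1..k}. X i \<omega> \<notin> torus_cball d n u (k - i) \<union> torus_cball d n v (k - i)}"
    unfolding missed_eq[OF assms(1)] missed_eq[OF assms(2)] by blast
  have "prob (missed k u \<inter> missed k v) =
      (\<Prod>i\<in>{1..k}. 1 - card (torus_cball d n u (k - i) \<union> torus_cball d n v (k - i)) / real n ^ d)"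
    unfolding both by (intro prob_avoid Un_least torus_cball_subset)
  also have "\<dots> = (\<Prod>i\<in>{1..k}. 1 - a u (k - i) - a v (k - i))"
    by (simp add: card_un a_def add_divide_distrib diff_diff_eq)
  also have "\<dots> \<le> (\<Prod>i\<in>{1..k}. (1 - a u (k - i)) * (1 - a v (k - i)))"
  proof (intro prod_mono conjI)
    fix i assume "i \<in> {1..k}"
    have "card (torus_cball d n u (k - i)) + card (torus_cball d n v (k - i)) =
        card (torus_cball d n u (k - i) \<union> torus_cball d n v (k - i))"
      by (rule card_un[symmetric])
    also have "\<dots> \<le> n ^ d"
      unfolding card_torus[symmetric] by (intro card_mono finite_torus Un_least torus_cball_subset)
    finally have "real (card (torus_cball d n u (k - i)) + card (torus_cball d n v (k - i))) \<le> real n ^ d"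
      by (simp only: of_nat_power [symmetric] of_nat_le_iff)
    then have "a u (k - i) + a v (k - i) \<le> 1"
      using n_pos by (simp add: a_def flip: add_divide_distrib)
    then show "0 \<le> 1 - a u (k - i) - a v (k - i)" by simp
    have "0 \<le> a u (k - i) * a v (k - i)" by (simp add: a_def)
    then show "1 - a u (k - i) - a v (k - i) \<le> (1 - a u (k - i)) * (1 - a v (k - i))"
      by (simp add: algebra_simps)
  qed
  also have "\<dots> = prob (missed k u) * prob (missed k v)"
    unfolding prod.distrib prob_missed[OF assms(1)] prob_missed[OF assms(2)] a_def
      prod_reverse[of "\<lambda>r. 1 - card (torus_cball d n _ r) / real n ^ d"] ..
  finally show ?thesis .
qed

text \<open>
  Second moment bound over a grid of spacing \<open>2 * k + 1\<close>, whose points have disjoint balls of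
  radius \<open>k\<close>.
\<close>

lemma prob_cc_time_le:
  assumes "0 \<le> \<eta>" "\<eta> < 1" "2 ^ d * real ((k + d) choose d) / real n ^ d \<le> \<eta>"
  shows "prob {\<omega> \<in> space M. cc_time d n (\<lambda>i. X i \<omega>) \<le> k} *
    (real (n div (2 * k + 1)) ^ d * exp (- (2 ^ d * real ((k + d) choose Suc d) / real n ^ d) / (1 - \<eta>))) \<le> 1"
proof -
  define s where "s = 2 * k + 1"
  define G where "G = torus_grid d s (n div s)"
  define p where "p = exp (- (2 ^ d * real ((k + d) choose Suc d) / real n ^ d) / (1 - \<eta>))"
  have s: "s \<ge> 1" "2 * k < s" by (auto simp: s_def)
  have G: "G \<subseteq> torus d n" unfolding G_def using separated_grid_subset[OF s(1)] .
  have fin: "finite G" by (simp add: G_def finite_torus_grid)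
  have ev: "(\<Union>v\<in>G. missed k v) \<in> events"
    using G fin missed_events by (intro sets.finite_UN) auto
  have "prob {\<omega> \<in> space M. cc_time d n (\<lambda>i. X i \<omega>) \<le> k} \<le> prob (space M - (\<Union>v\<in>G. missed k v))"
    using G ev by (intro finite_measure_mono) (auto simp: cc_time_le_eq)
  moreover have "real (n div s) ^ d * p \<le> (\<Sum>v\<in>G. prob (missed k v))"
  proof -
    have "real (n div s) ^ d * p = (\<Sum>v\<in>G. p)" using s(1) by (simp add: G_def card_torus_grid)
    also have "\<dots> \<le> (\<Sum>v\<in>G. prob (missed k v))"
      unfolding p_def using G assms by (intro sum_mono prob_missed_ge) auto
    finally show ?thesis .
  qed
  ultimately have "prob {\<omega> \<in> space M. cc_time d n (\<lambda>i. X i \<omega>) \<le> k} * (real (n div s) ^ d * p) \<le>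
      prob (space M - (\<Union>v\<in>G. missed k v)) * (\<Sum>v\<in>G. prob (missed k v))"
    by (intro mult_mono) (auto simp: p_def)
  also have "\<dots> \<le> 1"
    using G separated_grid_disjoint[OF n_pos s(2)]
    by (intro second_moment_avoidance fin missed_events prob_missed_both) (auto simp: G_def)
  finally show ?thesis by (simp add: s_def p_def)
qed

end

section \<open>Asymptotics of the time scale\<close>

lemma binomial_Suc_absorb: "Suc k * (m choose Suc k) = (m - k) * (m choose k)"
  by (metis binomial_absorb_comp binomial_absorption)

lemma power_le_fact_binomial: "(m - d) ^ Suc d \<le> fact (Suc d) * (m choose Suc d)"
proof (induction d)
  case (Suc d)
  have "(m - Suc d) ^ Suc (Suc d) \<le> (m - Suc d) * (m - d) ^ Suc d"
    unfolding power_Suc[of _ "Suc d"] by (intro mult_left_mono power_mono) auto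
  also have "\<dots> \<le> (m - Suc d) * (fact (Suc d) * (m choose Suc d))"
    by (intro mult_left_mono Suc) auto
  also have "\<dots> = fact (Suc d) * (Suc (Suc d) * (m choose Suc (Suc d)))"
    unfolding binomial_Suc_absorb by simp
  also have "\<dots> = fact (Suc (Suc d)) * (m choose Suc (Suc d))"
    by (simp add: algebra_simps)
  finally show ?case .
qed simp

lemma powr_root_power:
  fixes x :: real
  assumes "x > 0"
  shows "(x powr (1 / (real d + 1))) ^ Suc d = x"
proof -
  have "(x powr (1 / (real d + 1))) ^ Suc d = x powr ((real d + 1) * (1 / (real d + 1)))"
    by (subst powr_power) (use assms in \<open>auto simp: add.commute\<close>)
  then show ?thesis using assms by (simp add: add_nonneg_eq_0_iff)
qed

text \<open>
  The asserted asymptotic value of the covering time.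
\<close>

definition tau_scale :: "nat \<Rightarrow> nat \<Rightarrow> real" where
  "tau_scale d n = (fact d / 2 ^ d * real n ^ d * ln (real n ^ d)) powr (1 / (real d + 1))"

context
  fixes d :: nat
  assumes d: "d \<ge> 1"
begin

lemma ln_torus_at_top: "filterlim (\<lambda>n. ln (real n ^ d)) at_top sequentially"
proof -
  have "filterlim (\<lambda>n. real d * ln (real n)) at_top sequentially"
    using d by (intro filterlim_tendsto_pos_mult_at_top[OF tendsto_const]
        filterlim_compose[OF ln_at_top filterlim_real_sequentially]) auto
  then show ?thesis by (simp add: ln_realpow)
qed

lemma ln_torus_pos:
  assumes "n \<ge> 2"
  shows "ln (real n ^ d) > 0"
  using assms d by (simp add: ln_realpow)

lemma tau_scale_pos: "n \<ge> 2 \<Longrightarrow> tau_scale d n > 0"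
  using ln_torus_pos[of n] by (simp add: tau_scale_def)

lemma tau_scale_power:
  assumes "n \<ge> 2"
  shows "tau_scale d n ^ Suc d = fact d / 2 ^ d * real n ^ d * ln (real n ^ d)"
  unfolding tau_scale_def
  by (rule powr_root_power) (use ln_torus_pos[OF assms] assms in auto)

text \<open>
  The exponents of the two probability bounds at the time \<open>c * tau_scale d n\<close>: with \<open>N = n\<^sup>d\<close>, the
  probability that a given vertex is uncovered at that time is about \<open>N\<close> to the power
  \<open>- c\<^sup>d\<^sup>+\<^sup>1 / (d + 1)\<close>.
\<close>

lemma tau_scale_exponent:
  assumes "n \<ge> 2"
  shows "2 ^ d * ((c * tau_scale d n) ^ Suc d / fact (Suc d)) / real n ^ d =
    c ^ Suc d * ln (real n ^ d) / (real d + 1)"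
proof -
  have "p * (C * (F / p * N * L) / (D * F)) / N = C * L / D" if "p > 0" "N > 0" "F > 0" "D > 0"
    for p C F N L D :: real using that by simp
  from this[of "2 ^ d" "real n ^ d" "fact d" "real d + 1" "c ^ Suc d" "ln (real n ^ d)"]
  show ?thesis
    unfolding power_mult_distrib[of c] tau_scale_power[OF assms] fact_Suc
    using assms by (simp add: add.commute del: power_Suc)
qed

lemma tau_scale_eq_ln:
  assumes "n \<ge> 2"
  shows "tau_scale d n = (fact d / 2 ^ d) powr (1 / (real d + 1)) *
    (exp (ln (real n ^ d) / (real d + 1)) * ln (real n ^ d) powr (1 / (real d + 1)))"
proof -
  have "tau_scale d n = (fact d / 2 ^ d) powr (1 / (real d + 1)) *
    ((real n ^ d) powr (1 / (real d + 1)) * ln (real n ^ d) powr (1 / (real d + 1)))"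
  proof -
    have pm: "(x * y * z) powr e = x powr e * (y powr e * z powr e)" if "x > 0" "y > 0" "z > 0" for x y z e :: real
      using that by (simp add: powr_mult)
    show ?thesis
      unfolding tau_scale_def by (rule pm) (use ln_torus_pos[OF assms] assms in auto)
  qed
  also have "(real n ^ d) powr (1 / (real d + 1)) = exp (ln (real n ^ d) / (real d + 1))"
    using assms by (simp add: powr_def)
  finally show ?thesis .
qed

lemma tau_scale_at_top: "filterlim (tau_scale d) at_top sequentially"
proof -
  have "filterlim (\<lambda>x::real. (fact d / 2 ^ d) powr (1 / (real d + 1)) *
      (exp (x / (real d + 1)) * x powr (1 / (real d + 1)))) at_top at_top"
  proof (intro filterlim_tendsto_pos_mult_at_top[OF tendsto_const])
    define a where "a = real d + 1"
    have "a > 0" by (simp add: a_def)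
    then have "filterlim (\<lambda>x::real. exp (x / a) * x powr (1 / a)) at_top at_top" by real_asymp
    then show "filterlim (\<lambda>x::real. exp (x / (real d + 1)) * x powr (1 / (real d + 1))) at_top at_top"
      by (simp add: a_def)
  qed auto
  from filterlim_compose[OF this ln_torus_at_top] show ?thesis
    by (rule filterlim_cong[OF refl refl, THEN iffD2, rotated])
      (use tau_scale_eq_ln in \<open>auto intro!: eventually_sequentiallyI[of 2]\<close>)
qed

lemma tau_scale_over_n: "(\<lambda>n. tau_scale d n / real n) \<longlonglongrightarrow> 0"
proof -
  have "(\<lambda>n. (fact d / 2 ^ d * (real d * (ln (real n) / real n))) powr (1 / (real d + 1))) \<longlonglongrightarrow> 0"
  proof (rule tendsto_eq_rhs[OF tendsto_powr'])
    have "(\<lambda>n. ln (real n) / real n) \<longlonglongrightarrow> 0" by real_asymp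
    then show "(\<lambda>n. fact d / 2 ^ d * (real d * (ln (real n) / real n))) \<longlonglongrightarrow> 0"
      by (intro tendsto_mult_right_zero)
    show "((\<lambda>_. 1 / (real d + 1)) \<longlonglongrightarrow> 1 / (real d + 1))" by (rule tendsto_const)
  qed (auto intro!: eventually_sequentiallyI[of 1])
  moreover have "(fact d / 2 ^ d * (real d * (ln (real n) / real n))) powr (1 / (real d + 1)) =
      tau_scale d n / real n" if n: "n \<ge> 2" for n
  proof (rule power_eq_imp_eq_base[of _ "Suc d"])
    have "((fact d / 2 ^ d * (real d * (ln (real n) / real n))) powr (1 / (real d + 1))) ^ Suc d =
        fact d / 2 ^ d * (real d * (ln (real n) / real n))"
      using n d by (intro powr_root_power) auto
    also have "\<dots> = (tau_scale d n / real n) ^ Suc d"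
      unfolding power_divide tau_scale_power[OF n] using n by (simp add: ln_realpow)
    finally show "((fact d / 2 ^ d * (real d * (ln (real n) / real n))) powr (1 / (real d + 1))) ^ Suc d =
        (tau_scale d n / real n) ^ Suc d" .
  qed (use tau_scale_pos[OF n] in auto)
  ultimately show ?thesis
    by (blast intro: Lim_transform_eventually eventually_sequentiallyI[of 2])
qed

text \<open>
  Everything is expressed through \<open>ln N\<close> with \<open>N = n\<^sup>d\<close>. Since \<open>T\<^sup>d\<^sup>+\<^sup>1\<close> is a constant times \<open>N * ln N\<close>
  for \<open>T = tau_scale d n\<close>, the number \<open>(n / T)\<^sup>d = N * T / T\<^sup>d\<^sup>+\<^sup>1\<close> is a constant times \<open>T / ln N\<close>, hence of
  the order \<open>N\<close> to the power \<open>1 / (d + 1)\<close> up to logarithms.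
\<close>

lemma n_over_tau_scale:
  assumes "n \<ge> 2"
  shows "(real n / tau_scale d n) ^ d = (fact d / 2 ^ d) powr (1 / (real d + 1)) / (fact d / 2 ^ d) *
    (exp (ln (real n ^ d) / (real d + 1)) * ln (real n ^ d) powr (1 / (real d + 1)) / ln (real n ^ d))"
proof -
  have "(real n / tau_scale d n) ^ d = real n ^ d * tau_scale d n / tau_scale d n ^ Suc d"
    using tau_scale_pos[OF assms] by (simp add: power_divide)
  also have "\<dots> = tau_scale d n / (fact d / 2 ^ d) / ln (real n ^ d)"
    unfolding tau_scale_power[OF assms] using assms by simp
  finally show ?thesis unfolding tau_scale_eq_ln[OF assms] by (simp add: mult.assoc)
qed

text \<open>
  Up to constants, \<open>(n / tau_scale d n)\<^sup>d\<close> is the number of points of the grids used for both tail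
  bounds, and the exponential is the probability that a given point is uncovered. The expected number
  of uncovered grid points tends to 0 slightly above \<open>tau_scale d n\<close>, and to infinity slightly below.
\<close>

lemma cover_count_exp_tendsto_0:
  assumes "c > 0"
  shows "(\<lambda>n. (real n / tau_scale d n) ^ d * exp (- ((1 + c) * ln (real n ^ d) / (real d + 1)))) \<longlonglongrightarrow> 0"
proof -
  define K where "K = (fact d / 2 ^ d) powr (1 / (real d + 1)) / (fact d / 2 ^ d)"
  define a where "a = real d + 1"
  have a: "a > 1" using d by (simp add: a_def)
  define b where "b = 1 / a - 1"
  have b: "b < 0" using a by (simp add: b_def)
  define e where "e = c / a"
  have e: "e > 0" using a assms by (simp add: e_def)
  have "((\<lambda>x::real. x powr b * exp (- (e * x))) \<longlongrightarrow> 0) at_top" using b e by real_asymp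
  then have "((\<lambda>x::real. K * (x powr b * exp (- (e * x)))) \<longlongrightarrow> 0) at_top"
    by (rule tendsto_mult_right_zero)
  from filterlim_compose[OF this ln_torus_at_top]
  have "(\<lambda>n. K * (ln (real n ^ d) powr b * exp (- (e * ln (real n ^ d))))) \<longlonglongrightarrow> 0" .
  moreover have "K * (ln (real n ^ d) powr b * exp (- (e * ln (real n ^ d)))) =
     (real n / tau_scale d n) ^ d * exp (- ((1 + c) * ln (real n ^ d) / (real d + 1)))" if n: "n \<ge> 2" for n
  proof -
    define x where "x = ln (real n ^ d)"
    have x: "x > 0" using ln_torus_pos[OF n] by (simp add: x_def)
    have "(real n / tau_scale d n) ^ d * exp (- ((1 + c) * x / a)) =
        K * ((x powr (1 / a) / x) * (exp (x / a) * exp (- ((1 + c) * x / a))))"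
      unfolding n_over_tau_scale[OF n] by (simp add: K_def a_def x_def)
    also have "x powr (1 / a) / x = x powr b" using x by (simp add: b_def powr_diff)
    also have "exp (x / a) * exp (- ((1 + c) * x / a)) = exp (- (e * x))"
      using a by (simp add: e_def field_simps flip: exp_add)
    finally show ?thesis by (simp add: x_def a_def)
  qed
  ultimately show ?thesis
    by (blast intro: Lim_transform_eventually eventually_sequentiallyI[of 2])
qed

lemma separated_count_exp_at_top:
  assumes "c > 0"
  shows "filterlim (\<lambda>n. (real n / tau_scale d n) ^ d * exp (- ((1 - c) * ln (real n ^ d) / (real d + 1))))
    at_top sequentially"
proof -
  define K where "K = (fact d / 2 ^ d) powr (1 / (real d + 1)) / (fact d / 2 ^ d)"
  define a where "a = real d + 1"
  have a: "a > 1" using d by (simp add: a_def)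
  define b where "b = 1 / a - 1"
  have b: "b < 0" using a by (simp add: b_def)
  define e where "e = c / a"
  have e: "e > 0" using a assms by (simp add: e_def)
  have "filterlim (\<lambda>x::real. x powr b * exp (e * x)) at_top at_top" using b e by real_asymp
  then have "filterlim (\<lambda>x::real. K * (x powr b * exp (e * x))) at_top at_top"
    by (intro filterlim_tendsto_pos_mult_at_top[OF tendsto_const]) (auto simp: K_def)
  from filterlim_compose[OF this ln_torus_at_top]
  have *: "filterlim (\<lambda>n. K * (ln (real n ^ d) powr b * exp (e * ln (real n ^ d)))) at_top sequentially" .
  have eq: "(real n / tau_scale d n) ^ d * exp (- ((1 - c) * ln (real n ^ d) / (real d + 1))) =
     K * (ln (real n ^ d) powr b * exp (e * ln (real n ^ d)))" if n: "n \<ge> 2" for n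
  proof -
    define x where "x = ln (real n ^ d)"
    have x: "x > 0" using ln_torus_pos[OF n] by (simp add: x_def)
    have "(real n / tau_scale d n) ^ d * exp (- ((1 - c) * x / a)) =
        K * ((x powr (1 / a) / x) * (exp (x / a) * exp (- ((1 - c) * x / a))))"
      unfolding n_over_tau_scale[OF n] by (simp add: K_def a_def x_def)
    also have "x powr (1 / a) / x = x powr b" using x by (simp add: b_def powr_diff)
    also have "exp (x / a) * exp (- ((1 - c) * x / a)) = exp (e * x)"
      using a by (simp add: e_def field_simps flip: exp_add)
    finally show ?thesis by (simp add: x_def a_def)
  qed
  show ?thesis
    by (rule filterlim_cong[OF refl refl, THEN iffD2, OF _ *])
      (use eq in \<open>auto intro!: eventually_sequentiallyI[of 2]\<close>)
qed

end

section \<open>Convergence in probability\<close>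

lemma cc_time_upper_tail:
  fixes M :: "nat \<Rightarrow> 'a measure" and X :: "nat \<Rightarrow> nat \<Rightarrow> 'a \<Rightarrow> nat \<Rightarrow> int"
  assumes d: "d \<ge> 1" and "0 < \<epsilon>" "\<epsilon> \<le> 1"
    and seq: "\<And>n. n \<ge> 1 \<Longrightarrow> uniform_torus_sequence (M n) d n (X n)"
  shows "(\<lambda>n. measure (M n) {\<omega> \<in> space (M n). real (cc_time d n (\<lambda>i. X n i \<omega>)) > (1 + \<epsilon>) * tau_scale d n})
    \<longlonglongrightarrow> 0"
proof -
  define T where "T = tau_scale d"
  \<comment> \<open>Grid spacing: replacing a vertex by a nearby grid point costs at most \<open>d * s \<le> \<epsilon> * T / 2\<close> of the time.\<close>
  define s where "s = (\<lambda>n. nat \<lfloor>\<epsilon> * T n / (2 * real d)\<rfloor>)"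
  define k where "k = (\<lambda>n. nat \<lfloor>(1 + \<epsilon>) * T n\<rfloor>)"
  define B where "B = (\<lambda>n. (8 * real d / \<epsilon>) ^ d *
    ((real n / T n) ^ d * exp (- ((1 + \<epsilon> / 4) * ln (real n ^ d) / (real d + 1)))))"
  have T_large: "eventually (\<lambda>n. T n \<ge> c) sequentially" for c
    using tau_scale_at_top[OF d] by (simp add: T_def filterlim_at_top)
  have T_small: "eventually (\<lambda>n. T n / real n < 1 / 4) sequentially"
    unfolding T_def by (rule order_tendstoD(2)[OF tau_scale_over_n[OF d]]) simp
  have lim: "B \<longlonglongrightarrow> 0"
    unfolding B_def T_def using cover_count_exp_tendsto_0[OF d, of "\<epsilon> / 4"] assms
    by (intro tendsto_mult_right_zero) auto
  have bound: "eventually (\<lambda>n. measure (M n) {\<omega> \<in> space (M n).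
      real (cc_time d n (\<lambda>i. X n i \<omega>)) > (1 + \<epsilon>) * T n} \<le> B n) sequentially"
    using T_large[of "4 * real d / \<epsilon>"] T_large[of "4 * (1 + real d) / \<epsilon>"] T_small
      eventually_ge_at_top[of 2]
  proof eventually_elim
    case (elim n)
    interpret uniform_torus_sequence "M n" d n "X n" using seq elim by simp
    have Tpos: "T n > 0" using tau_scale_pos[OF d] elim by (simp add: T_def)
    have T1: "4 * (1 + real d) \<le> \<epsilon> * T n" "4 * real d \<le> \<epsilon> * T n"
      using elim assms by (simp_all add: field_simps)
    have n4: "4 * T n < real n" using elim by (simp add: field_simps)
    have s_le: "real (s n) \<le> \<epsilon> * T n / (2 * real d)"
      using Tpos assms unfolding s_def by (simp add: of_nat_floor)
    have "real (s n) > \<epsilon> * T n / (2 * real d) - 1"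
      unfolding s_def by linarith
    moreover have "1 \<le> \<epsilon> * T n / (4 * real d)" using T1 d by (simp add: field_simps)
    ultimately have s_ge: "real (s n) \<ge> \<epsilon> * T n / (4 * real d)"
      by (simp add: field_simps)
    have s1: "s n \<ge> 1" using s_ge \<open>1 \<le> \<epsilon> * T n / (4 * real d)\<close> by linarith
    have ds: "real (d * s n) \<le> \<epsilon> * T n / 2"
      using s_le d by (simp add: field_simps)
    have k_le: "real (k n) \<le> (1 + \<epsilon>) * T n"
      using Tpos assms unfolding k_def by (simp add: of_nat_floor)
    have k_gt: "real (k n) > (1 + \<epsilon>) * T n - 1"
      unfolding k_def by linarith
    have "real (d * s n) \<le> real (k n)"
      using ds k_gt T1(1) Tpos d assms by (simp add: algebra_simps)
    then have dsk: "d * s n \<le> k n" by (simp only: of_nat_le_iff)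
    have "\<epsilon> * T n \<le> 1 * T n" using Tpos assms by (intro mult_right_mono) auto
    then have "real (2 * (k n - d * s n)) \<le> real n"
      using k_le n4 by (simp add: algebra_simps)
    then have kn: "2 * (k n - d * s n) \<le> n" by (simp only: of_nat_le_iff)
    have "measure (M n) {\<omega> \<in> space (M n). real (cc_time d n (\<lambda>i. X n i \<omega>)) > (1 + \<epsilon>) * T n} \<le>
        measure (M n) {\<omega> \<in> space (M n). cc_time d n (\<lambda>i. X n i \<omega>) > k n}"
    proof (rule finite_measure_mono)
      show "{\<omega> \<in> space (M n). cc_time d n (\<lambda>i. X n i \<omega>) > k n} \<in> events"
        by (rule cc_time_events)
      show "{\<omega> \<in> space (M n). real (cc_time d n (\<lambda>i. X n i \<omega>)) > (1 + \<epsilon>) * T n} \<subseteq>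
          {\<omega> \<in> space (M n). cc_time d n (\<lambda>i. X n i \<omega>) > k n}"
        using k_le by force
    qed
    also have "\<dots> \<le> (real n / real (s n) + 1) ^ d *
        exp (- (2 ^ d * real ((k n - d * s n) choose Suc d) / real n ^ d))"
      using prob_cc_time_gt[OF s1 dsk kn] .
    also have "\<dots> \<le> (8 * real d / \<epsilon> * (real n / T n)) ^ d *
        exp (- ((1 + \<epsilon> / 4) * ln (real n ^ d) / (real d + 1)))"
    proof (intro mult_mono power_mono)
      have "real n / real (s n) \<le> real n / (\<epsilon> * T n / (4 * real d))"
        using s_ge s1 Tpos assms d by (intro divide_left_mono) auto
      moreover have "1 \<le> real n / (\<epsilon> * T n / (4 * real d))"
      proof -
        have "1 * real n \<le> 4 * real d * real n" using d by (intro mult_right_mono) auto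
        then have "\<epsilon> * T n \<le> 4 * real d * real n"
          using \<open>\<epsilon> * T n \<le> 1 * T n\<close> n4 Tpos by linarith
        then show ?thesis using Tpos assms d by (simp add: field_simps)
      qed
      moreover have "8 * real d / \<epsilon> * (real n / T n) = 2 * (real n / (\<epsilon> * T n / (4 * real d)))"
        by simp
      ultimately show "real n / real (s n) + 1 \<le> 8 * real d / \<epsilon> * (real n / T n)"
        by linarith
      define m where "m = k n - d * s n"
      have m_ge: "(1 + \<epsilon> / 4) * T n \<le> real (m - d)"
      proof -
        have "real m = real (k n) - real (d * s n)" using dsk by (simp add: m_def of_nat_diff)
        also have "\<dots> \<ge> (1 + \<epsilon> / 4) * T n + real d"
          using k_gt ds T1(1) by (simp add: algebra_simps)
        finally show ?thesis by linarith
      qed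
      have "(1 + \<epsilon> / 4) * ln (real n ^ d) / (real d + 1) \<le>
          (1 + \<epsilon> / 4) ^ Suc d * ln (real n ^ d) / (real d + 1)"
        using assms ln_torus_pos[OF d, of n] elim self_le_power[of "1 + \<epsilon> / 4" "Suc d"]
        by (intro divide_right_mono mult_right_mono) auto
      also have "\<dots> = 2 ^ d * (((1 + \<epsilon> / 4) * T n) ^ Suc d / fact (Suc d)) / real n ^ d"
        unfolding T_def by (rule tau_scale_exponent[OF d \<open>2 \<le> n\<close>, symmetric])
      also have "\<dots> \<le> 2 ^ d * real (m choose Suc d) / real n ^ d"
      proof (intro divide_right_mono mult_left_mono)
        have "((1 + \<epsilon> / 4) * T n) ^ Suc d \<le> real (m - d) ^ Suc d"
          using m_ge Tpos assms by (intro power_mono) auto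
        also have "\<dots> \<le> real (fact (Suc d) * (m choose Suc d))"
          using power_le_fact_binomial[of m d] by (simp only: of_nat_power [symmetric] of_nat_le_iff)
        finally show "((1 + \<epsilon> / 4) * T n) ^ Suc d / fact (Suc d) \<le> real (m choose Suc d)"
          by (simp add: field_simps del: fact_Suc power_Suc)
      qed auto
      finally show "exp (- (2 ^ d * real ((k n - d * s n) choose Suc d) / real n ^ d)) \<le>
          exp (- ((1 + \<epsilon> / 4) * ln (real n ^ d) / (real d + 1)))" by (simp add: m_def)
    qed (use Tpos assms d in auto)
    also have "\<dots> = B n" by (simp only: B_def power_mult_distrib mult.assoc)
    finally show ?case .
  qed
  have "(\<lambda>n. measure (M n) {\<omega> \<in> space (M n).
      real (cc_time d n (\<lambda>i. X n i \<omega>)) > (1 + \<epsilon>) * T n}) \<longlonglongrightarrow> 0"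
    by (rule tendsto_sandwich[OF _ bound tendsto_const lim]) simp
  then show ?thesis by (simp add: T_def)
qed

lemma cc_time_lower_tail:
  fixes M :: "nat \<Rightarrow> 'a measure" and X :: "nat \<Rightarrow> nat \<Rightarrow> 'a \<Rightarrow> nat \<Rightarrow> int"
  assumes d: "d \<ge> 1" and "0 < \<epsilon>" "\<epsilon> \<le> 1"
    and seq: "\<And>n. n \<ge> 1 \<Longrightarrow> uniform_torus_sequence (M n) d n (X n)"
  shows "(\<lambda>n. measure (M n) {\<omega> \<in> space (M n). real (cc_time d n (\<lambda>i. X n i \<omega>)) < (1 - \<epsilon>) * tau_scale d n})
    \<longlonglongrightarrow> 0"
proof -
  define T where "T = tau_scale d"
  define k where "k = (\<lambda>n. nat \<lfloor>(1 - \<epsilon>) * T n\<rfloor>)"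
  define B where "B = (\<lambda>n. (1 / 4) ^ d *
    ((real n / T n) ^ d * exp (- ((1 - \<epsilon> / 4) * ln (real n ^ d) / (real d + 1)))))"
  have T_large: "eventually (\<lambda>n. T n \<ge> c) sequentially" for c
    using tau_scale_at_top[OF d] by (simp add: T_def filterlim_at_top)
  have T_small: "eventually (\<lambda>n. T n / real n < 1 / 12) sequentially"
    unfolding T_def by (rule order_tendstoD(2)[OF tau_scale_over_n[OF d]]) simp
  have "(\<lambda>n. 2 ^ d * (T n / real n) ^ d) \<longlonglongrightarrow> 2 ^ d * 0 ^ d"
    unfolding T_def by (intro tendsto_intros tau_scale_over_n[OF d])
  then have frac_small: "eventually (\<lambda>n. 2 ^ d * (T n / real n) ^ d < \<epsilon> / 4) sequentially"
    by (rule order_tendstoD(2)) (use d assms in \<open>simp add: power_0_left\<close>)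
  have B_top: "filterlim B at_top sequentially"
    unfolding B_def T_def using separated_count_exp_at_top[OF d, of "\<epsilon> / 4"] assms
    by (intro filterlim_tendsto_pos_mult_at_top[OF tendsto_const]) auto
  then have lim: "(\<lambda>n. inverse (B n)) \<longlonglongrightarrow> 0"
    by (rule tendsto_inverse_0_at_top)
  have bound: "eventually (\<lambda>n. measure (M n) {\<omega> \<in> space (M n).
      real (cc_time d n (\<lambda>i. X n i \<omega>)) < (1 - \<epsilon>) * T n} \<le> inverse (B n)) sequentially"
    using T_large[of "2 * real d / \<epsilon>"] T_large[of 1] T_small frac_small
      eventually_ge_at_top[of 2]
  proof eventually_elim
    case (elim n)
    interpret uniform_torus_sequence "M n" d n "X n" using seq elim by simp
    have Tpos: "T n > 0" using tau_scale_pos[OF d] elim by (simp add: T_def)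
    have T1: "2 * real d \<le> \<epsilon> * T n"
      using elim assms by (simp add: field_simps)
    have n12: "12 * T n < real n" using elim by (simp add: field_simps)
    have k_le: "real (k n) \<le> (1 - \<epsilon>) * T n"
      using Tpos assms unfolding k_def by (simp add: of_nat_floor)
    have kd: "real (k n + d) \<le> (1 - \<epsilon> / 2) * T n"
      using k_le T1 by (simp add: algebra_simps)
    have kd': "real (k n + d) \<le> T n"
    proof -
      have "(1 - \<epsilon> / 2) * T n \<le> 1 * T n" using assms Tpos by (intro mult_right_mono) auto
      with kd show ?thesis by linarith
    qed
    have k_T: "real (k n) \<le> T n" using kd' by simp
    define P where "P = measure (M n) {\<omega> \<in> space (M n). cc_time d n (\<lambda>i. X n i \<omega>) \<le> k n}"
    have "measure (M n) {\<omega> \<in> space (M n). real (cc_time d n (\<lambda>i. X n i \<omega>)) < (1 - \<epsilon>) * T n} \<le> P"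
      unfolding P_def
    proof (rule finite_measure_mono[OF _ cc_time_events], safe)
      fix \<omega> assume "real (cc_time d n (\<lambda>i. X n i \<omega>)) < (1 - \<epsilon>) * T n"
      then show "cc_time d n (\<lambda>i. X n i \<omega>) \<le> k n" unfolding k_def by linarith
    qed
    also have "P \<le> inverse (B n)"
    proof -
      have frac: "2 ^ d * real ((k n + d) choose d) / real n ^ d \<le> \<epsilon> / 4"
      proof -
        have "real ((k n + d) choose d) \<le> real ((k n + d) ^ d)"
          by (rule of_nat_mono[OF order_trans[OF _ binomial_fact_pow]]) simp
        also have "\<dots> \<le> T n ^ d" unfolding of_nat_power using kd' by (intro power_mono) auto
        finally have "2 ^ d * real ((k n + d) choose d) / real n ^ d \<le> 2 ^ d * T n ^ d / real n ^ d"
          by (intro divide_right_mono mult_left_mono) auto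
        also have "\<dots> = 2 ^ d * (T n / real n) ^ d" by (simp add: power_divide)
        finally show ?thesis using elim by linarith
      qed
      have exponent: "2 ^ d * real ((k n + d) choose Suc d) / real n ^ d / (1 - \<epsilon> / 4) \<le>
          (1 - \<epsilon> / 4) * ln (real n ^ d) / (real d + 1)"
      proof -
        define L where "L = ln (real n ^ d)"
        have L: "L > 0" using ln_torus_pos[OF d, of n] elim by (simp add: L_def)
        have "real (((k n + d) choose Suc d) * fact (Suc d)) \<le> real ((k n + d) ^ Suc d)"
          by (intro of_nat_mono binomial_fact_pow)
        also have "\<dots> \<le> ((1 - \<epsilon> / 2) * T n) ^ Suc d"
          unfolding of_nat_power using kd by (intro power_mono) auto
        finally have "real ((k n + d) choose Suc d) \<le> ((1 - \<epsilon> / 2) * T n) ^ Suc d / fact (Suc d)"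
          by (simp add: field_simps del: fact_Suc power_Suc)
        then have "2 ^ d * real ((k n + d) choose Suc d) / real n ^ d \<le>
            2 ^ d * (((1 - \<epsilon> / 2) * T n) ^ Suc d / fact (Suc d)) / real n ^ d"
          by (intro divide_right_mono mult_left_mono) auto
        also have "\<dots> = (1 - \<epsilon> / 2) ^ Suc d * L / (real d + 1)"
          unfolding T_def L_def by (rule tau_scale_exponent[OF d \<open>2 \<le> n\<close>])
        also have "\<dots> \<le> (1 - \<epsilon> / 2) * L / (real d + 1)"
          using assms L power_decreasing[of 1 "Suc d" "1 - \<epsilon> / 2"]
          by (intro divide_right_mono mult_right_mono) auto
        \<comment> \<open>The factor \<open>1 / (1 - \<epsilon> / 4)\<close>, which the lower bound on \<open>1 - x\<close> costs in the exponent, is absorbed here.\<close>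
        also have "\<dots> \<le> ((1 - \<epsilon> / 4) * (1 - \<epsilon> / 4)) * L / (real d + 1)"
          using L by (intro divide_right_mono mult_right_mono) (auto simp: algebra_simps)
        finally have "2 ^ d * real ((k n + d) choose Suc d) / real n ^ d / (1 - \<epsilon> / 4) \<le>
            ((1 - \<epsilon> / 4) * (1 - \<epsilon> / 4)) * L / (real d + 1) / (1 - \<epsilon> / 4)"
          using assms by (intro divide_right_mono) auto
        also have "\<dots> = (1 - \<epsilon> / 4) * L / (real d + 1)"
          using assms by simp
        finally show ?thesis by (simp add: L_def)
      qed
      have count: "1 / 4 * (real n / T n) \<le> real (n div (2 * k n + 1))"
      proof -
        have "real n / (3 * T n) \<le> real n / real (2 * k n + 1)"
          using k_T elim Tpos by (intro divide_left_mono) auto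
        moreover have "real n / real (2 * k n + 1) < real (n div (2 * k n + 1)) + 1"
          using floor_divide_of_nat_eq[of n "2 * k n + 1", where ?'a = real] by linarith
        moreover have "1 / 4 * (real n / T n) + 1 \<le> real n / (3 * T n)"
          using n12 Tpos by (simp add: field_simps)
        ultimately show ?thesis by linarith
      qed
      have "B n = (1 / 4 * (real n / T n)) ^ d * exp (- ((1 - \<epsilon> / 4) * ln (real n ^ d) / (real d + 1)))"
        by (simp only: B_def power_mult_distrib mult.assoc)
      also have "\<dots> \<le> real (n div (2 * k n + 1)) ^ d *
          exp (- (2 ^ d * real ((k n + d) choose Suc d) / real n ^ d) / (1 - \<epsilon> / 4))"
        using count exponent Tpos by (intro mult_mono power_mono) auto
      finally have B_le: "B n \<le> \<dots>" .
      have "P * B n \<le> P * (real (n div (2 * k n + 1)) ^ d *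
          exp (- (2 ^ d * real ((k n + d) choose Suc d) / real n ^ d) / (1 - \<epsilon> / 4)))"
        using B_le by (intro mult_left_mono) (auto simp: P_def)
      also have "\<dots> \<le> 1"
        unfolding P_def using assms by (intro prob_cc_time_le frac) auto
      finally have "P * B n \<le> 1" .
      moreover have "B n > 0" using Tpos elim by (simp add: B_def)
      ultimately show ?thesis by (simp add: field_simps)
    qed
    finally show ?case .
  qed
  have "(\<lambda>n. measure (M n) {\<omega> \<in> space (M n).
      real (cc_time d n (\<lambda>i. X n i \<omega>)) < (1 - \<epsilon>) * T n}) \<longlonglongrightarrow> 0"
    by (rule tendsto_sandwich[OF _ bound tendsto_const lim]) simp
  then show ?thesis by (simp add: T_def)
qed

theorem theorem1:
  fixes d :: nat
    and M :: "nat \<Rightarrow> 'a measure"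
    and X :: "nat \<Rightarrow> nat \<Rightarrow> 'a \<Rightarrow> nat \<Rightarrow> int"
  assumes "d \<ge> 1"
    and "\<And>n. n \<ge> 1 \<Longrightarrow> prob_space (M n)"
    and "\<And>n. n \<ge> 1 \<Longrightarrow>
           prob_space.indep_vars (M n) (\<lambda>_. count_space (torus d n)) (X n) {1..}"
    and "\<And>n i. n \<ge> 1 \<Longrightarrow> i \<ge> 1 \<Longrightarrow>
           distr (M n) (count_space (torus d n)) (X n i) = uniform_count_measure (torus d n)"
  shows "tendsto_in_prob M
           (\<lambda>n \<omega>. (fact d / 2 ^ d * real n ^ d * ln (real n ^ d)) powr (- 1 / (real d + 1))
                  * real (cc_time d n (\<lambda>i. X n i \<omega>))) 1"
  unfolding tendsto_in_prob_def
proof (intro allI impI)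
  fix \<epsilon> :: real assume "\<epsilon> > 0"
  \<comment> \<open>The tail bounds are for \<open>\<epsilon> \<le> 1\<close>; a smaller tolerance only enlarges the event.\<close>
  define \<delta> where "\<delta> = min \<epsilon> 1"
  have \<delta>: "0 < \<delta>" "\<delta> \<le> 1" "\<delta> \<le> \<epsilon>" using \<open>\<epsilon> > 0\<close> by (auto simp: \<delta>_def)
  have seq: "uniform_torus_sequence (M n) d n (X n)" if "n \<ge> 1" for n
    using assms that by (simp add: uniform_torus_sequence_def uniform_torus_sequence_axioms_def)
  define U where "U = (\<lambda>n. {\<omega> \<in> space (M n). real (cc_time d n (\<lambda>i. X n i \<omega>)) > (1 + \<delta>) * tau_scale d n})"
  define V where "V = (\<lambda>n. {\<omega> \<in> space (M n). real (cc_time d n (\<lambda>i. X n i \<omega>)) < (1 - \<delta>) * tau_scale d n})"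
  let ?Y = "\<lambda>n \<omega>. (fact d / 2 ^ d * real n ^ d * ln (real n ^ d)) powr (- 1 / (real d + 1))
                  * real (cc_time d n (\<lambda>i. X n i \<omega>))"
  have lim: "(\<lambda>n. measure (M n) (U n) + measure (M n) (V n)) \<longlonglongrightarrow> 0"
    unfolding U_def V_def
    by (intro tendsto_add_zero cc_time_upper_tail cc_time_lower_tail seq assms(1) \<delta>(1,2))
  have bound: "eventually (\<lambda>n. measure (M n) {\<omega> \<in> space (M n). \<bar>?Y n \<omega> - 1\<bar> > \<epsilon>} \<le>
      measure (M n) (U n) + measure (M n) (V n)) sequentially"
  proof (rule eventually_sequentiallyI[of 2])
    fix n :: nat assume n: "n \<ge> 2"
    interpret uniform_torus_sequence "M n" d n "X n" using seq n by simp
    have T: "tau_scale d n > 0" using tau_scale_pos[OF assms(1) n] .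
    have Y: "?Y n \<omega> = real (cc_time d n (\<lambda>i. X n i \<omega>)) / tau_scale d n" for \<omega>
      by (simp add: tau_scale_def powr_minus_divide)
    have meas: "U n \<in> events" "V n \<in> events"
      unfolding U_def V_def by (rule cc_time_events)+
    have "{\<omega> \<in> space (M n). \<bar>?Y n \<omega> - 1\<bar> > \<epsilon>} \<subseteq> U n \<union> V n"
    proof
      fix \<omega> assume \<omega>: "\<omega> \<in> {\<omega> \<in> space (M n). \<bar>?Y n \<omega> - 1\<bar> > \<epsilon>}"
      then have "?Y n \<omega> > 1 + \<delta> \<or> ?Y n \<omega> < 1 - \<delta>" using \<delta>(3) by auto
      then show "\<omega> \<in> U n \<union> V n"
        using \<omega> T unfolding Y by (auto simp: U_def V_def field_simps)
    qed
    then have "measure (M n) {\<omega> \<in> space (M n). \<bar>?Y n \<omega> - 1\<bar> > \<epsilon>} \<le> measure (M n) (U n \<union> V n)"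
      using meas by (intro finite_measure_mono sets.Un)
    also have "\<dots> \<le> measure (M n) (U n) + measure (M n) (V n)"
      using meas by (rule measure_Un_le)
    finally show "measure (M n) {\<omega> \<in> space (M n). \<bar>?Y n \<omega> - 1\<bar> > \<epsilon>} \<le>
      measure (M n) (U n) + measure (M n) (V n)" .
  qed
  show "(\<lambda>n. measure (M n) {\<omega> \<in> space (M n). \<bar>?Y n \<omega> - 1\<bar> > \<epsilon>}) \<longlonglongrightarrow> 0"
    by (rule tendsto_sandwich[OF _ bound tendsto_const lim]) simp
qed

end
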